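(* Let $n>1$ be an integer, and for each row index $i$ (in an index set $I$) let nonzero complex Boltzmann weights $\mathtt a_1^{(i)}$, $\mathtt a_2^{(i)}(a)$, $\mathtt b_1^{(i)}$, $\mathtt b_2^{(i)}(a)$, $\mathtt c_1^{(i)}$, $\mathtt c_2^{(i)}$ ($a\in\mathbb Z/n\mathbb Z$) of the six-vertex model with charge be given. The model is solvable if and only if at least one of the following two conditions holds. (1) (Generalized free fermion condition associated to a metaplectic Fock space.) There is a function $g:\mathbb Z/n\mathbb Z\to\mathbb C^\times$ with $g(a)g(-a)=-g(0)$ for all $a\ne0$ such that for every $i\in I$, $$\mathtt a_1^{(i)}\mathtt a_2^{(i)}(0)+\mathtt b_1^{(i)}\mathtt b_2^{(i)}(0)-\mathtt c_1^{(i)}\mathtt c_2^{(i)}=0\qquad\text{and}\qquad\frac{\mathtt a_1^{(i)}\mathtt a_2^{(i)}(a)}{\mathtt b_1^{(i)}\mathtt b_2^{(i)}(a)}=g(a)\ \text{ for all } a\in\mathbb Z/n\mathbb Z.$$ (2) The quantities $$\frac{\mathtt a_1^{(i)}\mathtt a_2^{(i)}(k)}{\mathtt b_1^{(i)}\mathtt b_2^{(i)}(k)}\ (k\in\mathbb Z/n\mathbb Z),\qquad \frac{\mathtt a_1^{(i)}\mathtt a_2^{(i)}(0)}{\mathtt c_1^{(i)}\mathtt c_2^{(i)}},\qquad\frac{\mathtt b_1^{(i)}\mathtt b_2^{(i)}(0)}{\mathtt c_1^{(i)}\mathtt c_2^{(i)}}$$ are independent of $i$, and for all $i,j\in I$,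 $$\prod_{p=0}^{n-1}\mathtt a_1^{(i)}\mathtt b_2^{(j)}(p)=\prod_{p=0}^{n-1}\mathtt a_1^{(j)}\mathtt b_2^{(i)}(p).$$
   Context: Spins. Vertical edges carry a spin $+$ or $-$. Horizontal edges carry a decorated spin: either $+$, or $-$ together with a charge in $\mathbb Z/n\mathbb Z$ (written $-_a$). Rectangular vertices $T_i$ (row $i$), written (left, top, right, bottom), with all others having weight $0$: $\mathtt a_1^{(i)}=(+,+,+,+)$; $\mathtt a_2^{(i)}(a)=(-_{a+1},-,-_a,-)$; $\mathtt b_1^{(i)}=(+,-,+,-)$; $\mathtt b_2^{(i)}(a)=(-_{a+1},+,-_a,+)$; $\mathtt c_1^{(i)}=(-_1,+,+,-)$; $\mathtt c_2^{(i)}=(+,-,-_0,+)$. The same symbols denote the weights. $R$-vertices $R_{ij}$: four horizontal edges (top left, bottom left, top right, bottom right), each with a decorated spin, with a complex weight. Conservation of decorated spin is required: the weight is $0$ unless the multiset of the two left decorated spins equals the multiset of the two right decorated spins. Solvability. The model is solvable if for all $i,j\in I$ there is a choice of weights $R_{ij}$ of this kind, not identically zero, such that for all decorated spins $\alpha,\beta,\delta,\epsilon$ and vertical spins $\gamma,\eta$ the following Yang–Baxter equation holds: $$\sum_{\sigma,\tau,\kappa}R_{ij}\!\left(\beta,\alpha;\sigma,\tau\right)\,T_i(\sigma,\gamma,\delta,\kappa)\,T_j(\tau,\kappa,\epsilon,\eta)=\sum_{\sigma,\tau,\kappa}T_j(\beta,\gamma,\sigma,\kappa)\,T_i(\alpha,\kappa,\tau,\eta)\,R_{ij}(\sigma,\tau;\delta,\epsilon),$$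 where $R_{ij}(w,x;y,z)$ is the weight with top left $w$, bottom left $x$, top right $y$, bottom right $z$; $T_i(\text{left},\text{top},\text{right},\text{bottom})$ is the vertex weight; $\sigma,\tau$ run over decorated spins and $\kappa$ over $\{+,-\}$. A metaplectic Fock space (a shift-invariant Drinfeld–Reshetikhin twist of $q$-Fock space) is determined by a function $g$ on $\mathbb Z/n\mathbb Z$ with nonzero values and $g(a)g(-a)=-g(0)$ for $a\ne0$. *)

theory Defs
  imports
    "HOL-Analysis.Analysis"
    "HOL-Library.Multiset"
    "Berlekamp_Zassenhaus.Finite_Field"
begin

datatype spin = Plus | Minus

text \<open>Decorated spins. The charge type \<open>'c\<close> is always instantiated to \<open>'n mod_ring\<close>, the ring of
  integers modulo \<open>n = CARD('n)\<close>; the sort \<open>nontriv\<close> on \<open>'n\<close> says \<open>CARD('n) > 1\<close>.\<close>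

datatype 'c dspin = DPlus | DMinus 'c

instance spin :: finite
proof
  have "(UNIV :: spin set) \<subseteq> {Plus, Minus}"
    using spin.exhaust by blast
  then show "finite (UNIV :: spin set)"
    by (rule finite_subset) simp
qed

instance dspin :: (finite) finite
proof
  have "(UNIV :: 'a dspin set) \<subseteq> insert DPlus (range DMinus)"
    using dspin.exhaust by blast
  then show "finite (UNIV :: 'a dspin set)"
    by (rule finite_subset) simp
qed

record 'c row_weights =
  a1 :: complex
  a2 :: "'c \<Rightarrow> complex"
  b1 :: complex
  b2 :: "'c \<Rightarrow> complex"
  c1 :: complex
  c2 :: complex

text \<open>The arguments of \<open>T_weight\<close> after the row are in the order left, top, right, bottom. The charge
  argument of \<open>a2\<close> and \<open>b2\<close> is the charge of the right edge.\<close>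

fun T_weight ::
  "'n::nontriv mod_ring row_weights \<Rightarrow>
    'n mod_ring dspin \<Rightarrow> spin \<Rightarrow> 'n mod_ring dspin \<Rightarrow> spin \<Rightarrow> complex" where
  "T_weight w DPlus Plus DPlus Plus = a1 w"
| "T_weight w (DMinus b) Minus (DMinus a) Minus = (if b = a + 1 then a2 w a else 0)"
| "T_weight w DPlus Minus DPlus Minus = b1 w"
| "T_weight w (DMinus b) Plus (DMinus a) Plus = (if b = a + 1 then b2 w a else 0)"
| "T_weight w (DMinus b) Plus DPlus Minus = (if b = 1 then c1 w else 0)"
| "T_weight w DPlus Minus (DMinus a) Plus = (if a = 0 then c2 w else 0)"
| "T_weight w _ _ _ _ = 0"

text \<open>The arguments of an \<open>R\<close>-weight are in the order top left, bottom left, top right, bottom right.\<close>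

type_synonym 'c R_weight = "'c dspin \<Rightarrow> 'c dspin \<Rightarrow> 'c dspin \<Rightarrow> 'c dspin \<Rightarrow> complex"

definition spin_conserving :: "'c R_weight \<Rightarrow> bool" where
  "spin_conserving R \<longleftrightarrow> (\<forall>w x y z. {#w, x#} \<noteq> {#y, z#} \<longrightarrow> R w x y z = 0)"

definition yang_baxter ::
  "'n::nontriv mod_ring R_weight \<Rightarrow> 'n mod_ring row_weights \<Rightarrow> 'n mod_ring row_weights \<Rightarrow> bool" where
  "yang_baxter R v w \<longleftrightarrow>
    (\<forall>\<alpha> \<beta> \<delta> \<epsilon> \<gamma> \<eta>.
      (\<Sum>\<sigma>\<in>UNIV. \<Sum>\<tau>\<in>UNIV. \<Sum>\<kappa>\<in>UNIV.
        R \<beta> \<alpha> \<sigma> \<tau> * T_weight v \<sigma> \<gamma> \<delta> \<kappa> * T_weight w \<tau> \<kappa> \<epsilon> \<eta>) =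
      (\<Sum>\<sigma>\<in>UNIV. \<Sum>\<tau>\<in>UNIV. \<Sum>\<kappa>\<in>UNIV.
        T_weight w \<beta> \<gamma> \<sigma> \<kappa> * T_weight v \<alpha> \<kappa> \<tau> \<eta> * R \<sigma> \<tau> \<delta> \<epsilon>))"

definition solvable :: "'i set \<Rightarrow> ('i \<Rightarrow> 'n::nontriv mod_ring row_weights) \<Rightarrow> bool" where
  "solvable I W \<longleftrightarrow>
    (\<forall>i\<in>I. \<forall>j\<in>I. \<exists>R.
      spin_conserving R \<and> (\<exists>w x y z. R w x y z \<noteq> 0) \<and> yang_baxter R (W i) (W j))"

definition nonzero_weights :: "'c row_weights \<Rightarrow> bool" where
  "nonzero_weights w \<longleftrightarrow>
    a1 w \<noteq> 0 \<and> (\<forall>a. a2 w a \<noteq> 0) \<and> b1 w \<noteq> 0 \<and> (\<forall>a. b2 w a \<noteq> 0) \<and> c1 w \<noteq> 0 \<and> c2 w \<noteq> 0"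

text \<open>The functions that determine a metaplectic Fock space.\<close>

definition metaplectic :: "('n::nontriv mod_ring \<Rightarrow> complex) \<Rightarrow> bool" where
  "metaplectic g \<longleftrightarrow> (\<forall>a. g a \<noteq> 0) \<and> (\<forall>a. a \<noteq> 0 \<longrightarrow> g a * g (- a) = - g 0)"

definition free_fermionic ::
  "('n::nontriv mod_ring \<Rightarrow> complex) \<Rightarrow> 'n mod_ring row_weights \<Rightarrow> bool" where
  "free_fermionic g w \<longleftrightarrow>
    a1 w * a2 w 0 + b1 w * b2 w 0 - c1 w * c2 w = 0 \<and>
    (\<forall>a. (a1 w * a2 w a) / (b1 w * b2 w a) = g a)"

end

theory Submission
  imports Defs
begin

text \<open>Spin conservation leaves seven kinds of entries of an \<open>R\<close>-matrix: \<open>A\<close> for two plus spins; \<open>U\<close>, \<open>V\<close> (spins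
  stay) and \<open>X\<close>, \<open>Y\<close> (spins are exchanged) for one plus and one minus spin; \<open>P\<close>, \<open>Q\<close> (stay, exchanged) for two
  minus spins. The Yang--Baxter equation forces \<open>X\<close>, \<open>Y\<close> and the diagonal \<open>D\<close> of \<open>P\<close> to be independent of the
  charge and becomes a finite list of equations with a single product on most sides.

  If \<open>U\<close> vanishes at one charge then \<open>R = 0\<close>. Otherwise the recursions for \<open>U\<close> and \<open>P\<close> force the ratios
  \<open>a1 a2(k) / (b1 b2(k))\<close> and \<open>c1 c2 / (b1 b2(0))\<close> of the two rows to agree. Going once around the charges
  shows that \<open>X = 0\<close> is equivalent to the product condition. If \<open>X \<noteq> 0\<close>, the entries \<open>Q\<close> give
  \<open>g(a) g(-a) = -g(0)\<close>, and eliminating \<open>A\<close> gives \<open>a1 a2(0) + b1 b2(0) - c1 c2 = 0\<close>. Conversely these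
  conditions on a pair of rows suffice to solve all equations. Both alternatives for a pair depend on the
  ratios only through quantities shared by all rows, so the dichotomy holds for all rows at once.\<close>

section \<open>Conserving R-weights\<close>

lemma doubleton_mset_eq_iff:
  "{#w, x#} = {#y, z#} \<longleftrightarrow> w = y \<and> x = z \<or> w = z \<and> x = y"
  by (subst add_eq_conv_ex) auto

lemma UNIV_spin: "UNIV = {Plus, Minus}"
  using spin.exhaust by blast

text \<open>Both sides of the Yang--Baxter equation contain one column of two rows, in opposite
  orders. This is its weight with the inner vertical spin summed out; the first row argument is the
  upper row.\<close>

definition column_weight ::
  "'n::nontriv mod_ring row_weights \<Rightarrow> 'n mod_ring row_weights \<Rightarrow>
    'n mod_ring dspin \<Rightarrow> 'n mod_ring dspin \<Rightarrow> spin \<Rightarrow>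
    'n mod_ring dspin \<Rightarrow> 'n mod_ring dspin \<Rightarrow> spin \<Rightarrow> complex" where
  "column_weight v w \<sigma> \<tau> \<gamma> \<delta> \<epsilon> \<eta> =
    T_weight v \<sigma> \<gamma> \<delta> Plus * T_weight w \<tau> Plus \<epsilon> \<eta> +
    T_weight v \<sigma> \<gamma> \<delta> Minus * T_weight w \<tau> Minus \<epsilon> \<eta>"

text \<open>Conservation leaves only the pairs \<open>(\<beta>, \<alpha>)\<close> and
  \<open>(\<alpha>, \<beta>)\<close>. They coincide for equal spins, and the conditional keeps that
  term from being counted twice.\<close>

lemma sum_conserving_left:
  fixes R :: "'c::finite R_weight"
  assumes "spin_conserving R"
  shows "(\<Sum>\<sigma>\<in>UNIV. \<Sum>\<tau>\<in>UNIV. R \<beta> \<alpha> \<sigma> \<tau> * F \<sigma> \<tau>) =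
    R \<beta> \<alpha> \<beta> \<alpha> * F \<beta> \<alpha> + (if \<alpha> = \<beta> then 0 else R \<beta> \<alpha> \<alpha> \<beta> * F \<alpha> \<beta>)"
proof -
  have zero: "R \<beta> \<alpha> \<sigma> \<tau> = 0"
    if "(\<sigma>, \<tau>) \<notin> {(\<beta>, \<alpha>), (\<alpha>, \<beta>)}" for \<sigma> \<tau>
  proof -
    have "{#\<beta>, \<alpha>#} \<noteq> {#\<sigma>, \<tau>#}"
      using that unfolding doubleton_mset_eq_iff by blast
    with assms show ?thesis
      unfolding spin_conserving_def by blast
  qed
  have "(\<Sum>\<sigma>\<in>UNIV. \<Sum>\<tau>\<in>UNIV. R \<beta> \<alpha> \<sigma> \<tau> * F \<sigma> \<tau>) =
    (\<Sum>p\<in>UNIV. R \<beta> \<alpha> (fst p) (snd p) * F (fst p) (snd p))"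
    by (subst sum.cartesian_product) (simp add: case_prod_unfold)
  also have "\<dots> = (\<Sum>p\<in>{(\<beta>, \<alpha>), (\<alpha>, \<beta>)}. R \<beta> \<alpha> (fst p) (snd p) * F (fst p) (snd p))"
    by (intro sum.mono_neutral_right ballI) (simp_all add: zero del: insert_iff split_paired_All)
  finally show ?thesis
    by (cases "\<alpha> = \<beta>") simp_all
qed

lemma sum_conserving_right:
  fixes R :: "'c::finite R_weight"
  assumes "spin_conserving R"
  shows "(\<Sum>\<sigma>\<in>UNIV. \<Sum>\<tau>\<in>UNIV. F \<sigma> \<tau> * R \<sigma> \<tau> \<delta> \<epsilon>) =
    F \<delta> \<epsilon> * R \<delta> \<epsilon> \<delta> \<epsilon> + (if \<epsilon> = \<delta> then 0 else F \<epsilon> \<delta> * R \<epsilon> \<delta> \<delta> \<epsilon>)"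
proof -
  \<comment> \<open>Conservation is symmetric under reflection, which exchanges the left and the
    right edges.\<close>
  have "spin_conserving (\<lambda>w x y z. R y z w x)"
    using assms by (auto simp: spin_conserving_def)
  from sum_conserving_left[OF this, of \<delta> \<epsilon> F] show ?thesis
    by (simp add: mult.commute)
qed

lemma yang_baxter_conserving:
  assumes "spin_conserving R"
  shows "yang_baxter R v w \<longleftrightarrow> (\<forall>\<alpha> \<beta> \<delta> \<epsilon> \<gamma> \<eta>.
    R \<beta> \<alpha> \<beta> \<alpha> * column_weight v w \<beta> \<alpha> \<gamma> \<delta> \<epsilon> \<eta> +
      (if \<alpha> = \<beta> then 0 else R \<beta> \<alpha> \<alpha> \<beta> * column_weight v w \<alpha> \<beta> \<gamma> \<delta> \<epsilon> \<eta>) =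
    column_weight w v \<beta> \<alpha> \<gamma> \<delta> \<epsilon> \<eta> * R \<delta> \<epsilon> \<delta> \<epsilon> +
      (if \<epsilon> = \<delta> then 0 else column_weight w v \<beta> \<alpha> \<gamma> \<epsilon> \<delta> \<eta> * R \<epsilon> \<delta> \<delta> \<epsilon>))"
proof -
  have "(\<Sum>\<sigma>\<in>UNIV. \<Sum>\<tau>\<in>UNIV. \<Sum>\<kappa>\<in>UNIV.
        R \<beta> \<alpha> \<sigma> \<tau> * T_weight v \<sigma> \<gamma> \<delta> \<kappa> * T_weight w \<tau> \<kappa> \<epsilon> \<eta>) =
      (\<Sum>\<sigma>\<in>UNIV. \<Sum>\<tau>\<in>UNIV. R \<beta> \<alpha> \<sigma> \<tau> * column_weight v w \<sigma> \<tau> \<gamma> \<delta> \<epsilon> \<eta>)"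
    for \<alpha> \<beta> \<delta> \<epsilon> \<gamma> \<eta>
    by (simp add: UNIV_spin column_weight_def algebra_simps)
  moreover have "(\<Sum>\<sigma>\<in>UNIV. \<Sum>\<tau>\<in>UNIV. \<Sum>\<kappa>\<in>UNIV.
        T_weight w \<beta> \<gamma> \<sigma> \<kappa> * T_weight v \<alpha> \<kappa> \<tau> \<eta> * R \<sigma> \<tau> \<delta> \<epsilon>) =
      (\<Sum>\<sigma>\<in>UNIV. \<Sum>\<tau>\<in>UNIV. column_weight w v \<beta> \<alpha> \<gamma> \<sigma> \<tau> \<eta> * R \<sigma> \<tau> \<delta> \<epsilon>)"
    for \<alpha> \<beta> \<delta> \<epsilon> \<gamma> \<eta>
    by (simp add: UNIV_spin column_weight_def algebra_simps)
  ultimately show ?thesis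
    unfolding yang_baxter_def
    by (simp only: sum_conserving_left[OF assms] sum_conserving_right[OF assms])
qed

text \<open>For two minus spins of equal charge, staying and being exchanged are the same
  configuration; its weight is \<open>P a a\<close>.\<close>

fun six_R ::
  "complex \<Rightarrow> ('c \<Rightarrow> complex) \<Rightarrow> ('c \<Rightarrow> complex) \<Rightarrow> ('c \<Rightarrow> complex) \<Rightarrow> ('c \<Rightarrow> complex) \<Rightarrow>
    ('c \<Rightarrow> 'c \<Rightarrow> complex) \<Rightarrow> ('c \<Rightarrow> 'c \<Rightarrow> complex) \<Rightarrow> 'c R_weight" where
  "six_R A U V X Y P Q DPlus DPlus DPlus DPlus = A"
| "six_R A U V X Y P Q DPlus (DMinus a) DPlus (DMinus b) = (if a = b then U a else 0)"
| "six_R A U V X Y P Q (DMinus a) DPlus (DMinus b) DPlus = (if a = b then V a else 0)"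
| "six_R A U V X Y P Q DPlus (DMinus a) (DMinus b) DPlus = (if a = b then X a else 0)"
| "six_R A U V X Y P Q (DMinus a) DPlus DPlus (DMinus b) = (if a = b then Y a else 0)"
| "six_R A U V X Y P Q (DMinus a) (DMinus b) (DMinus c) (DMinus d) =
    (if a = c \<and> b = d then P a b else if a = d \<and> b = c then Q a b else 0)"
| "six_R A U V X Y P Q _ _ _ _ = 0"

lemma spin_conserving_six_R: "spin_conserving (six_R A U V X Y P Q)"
proof -
  have "w = y \<and> x = z \<or> w = z \<and> x = y" if "six_R A U V X Y P Q w x y z \<noteq> 0" for w x y z
    using that by (cases w; cases x; cases y; cases z) (simp_all split: if_splits)
  then show ?thesis
    unfolding spin_conserving_def doubleton_mset_eq_iff by blast
qed

lemma conserving_eq_six_R: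
  fixes R :: "'a dspin \<Rightarrow> 'a dspin \<Rightarrow> 'a dspin \<Rightarrow> 'a dspin \<Rightarrow> complex"
  assumes "spin_conserving R"
  shows "R = six_R (R DPlus DPlus DPlus DPlus)
    (\<lambda>a. R DPlus (DMinus a) DPlus (DMinus a)) (\<lambda>a. R (DMinus a) DPlus (DMinus a) DPlus)
    (\<lambda>a. R DPlus (DMinus a) (DMinus a) DPlus) (\<lambda>a. R (DMinus a) DPlus DPlus (DMinus a))
    (\<lambda>a b. R (DMinus a) (DMinus b) (DMinus a) (DMinus b))
    (\<lambda>a b. R (DMinus a) (DMinus b) (DMinus b) (DMinus a))"
proof (intro ext)
  have zero: "R w x y z = 0" if "\<not> (w = y \<and> x = z)" "\<not> (w = z \<and> x = y)" for w x y z
    using assms that unfolding spin_conserving_def doubleton_mset_eq_iff by blast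
  fix w x y z :: "'a dspin"
  show "R w x y z = six_R (R DPlus DPlus DPlus DPlus)
    (\<lambda>a. R DPlus (DMinus a) DPlus (DMinus a)) (\<lambda>a. R (DMinus a) DPlus (DMinus a) DPlus)
    (\<lambda>a. R DPlus (DMinus a) (DMinus a) DPlus) (\<lambda>a. R (DMinus a) DPlus DPlus (DMinus a))
    (\<lambda>a b. R (DMinus a) (DMinus b) (DMinus a) (DMinus b))
    (\<lambda>a b. R (DMinus a) (DMinus b) (DMinus b) (DMinus a)) w x y z"
    by (cases w; cases x; cases y; cases z) (simp_all add: zero)
qed

section \<open>The Yang--Baxter equation in components\<close>

text \<open>Each equation is one component of the Yang--Baxter equation. In \<open>A1\<close> to
  \<open>A4\<close> one side has two plus spins, in \<open>D1\<close> to \<open>D4\<close> two minus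
  spins of equal charge. The wrap equations pass from charge \<open>0\<close> to \<open>1\<close>,
  where a pair of c-vertices contributes an exchange term with \<open>X\<close> or \<open>Y\<close>;
  at nonzero charges no such term occurs.\<close>

locale ybe_system =
  fixes A D X Y :: complex and U V :: "'n::nontriv mod_ring \<Rightarrow> complex"
    and P Q :: "'n mod_ring \<Rightarrow> 'n mod_ring \<Rightarrow> complex"
    and v w :: "'n mod_ring row_weights"
  assumes nonzero_v: "nonzero_weights v" and nonzero_w: "nonzero_weights w"
    and P_diag: "P a a = D"
    and A1: "A * b1 v * c2 w = U 0 * b1 w * c2 v + Y * a1 v * c2 w"
    and A2: "A * a1 w * c2 v = X * b1 w * c2 v + V 0 * a1 v * c2 w"
    and A3: "V 1 * b1 w * c1 v + Y * a1 v * c1 w = A * b1 v * c1 w"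
    and A4: "X * b1 w * c1 v + U 1 * a1 v * c1 w = A * a1 w * c1 v"
    and V1_U0: "V 1 * c1 v * c2 w = U 0 * c1 w * c2 v"
    and U1_V0: "U 1 * c1 w * c2 v = V 0 * c1 v * c2 w"
    and V_wrap_b2: "V 1 * a1 w * b2 v 0 = V 0 * a1 v * b2 w 0 + X * c1 w * c2 v"
    and U_wrap_b2: "U 1 * a1 v * b2 w 0 + X * c1 v * c2 w = U 0 * a1 w * b2 v 0"
    and V_wrap_a2: "V 1 * a2 v 0 * b1 w + Y * c1 w * c2 v = V 0 * a2 w 0 * b1 v"
    and U_wrap_a2: "U 1 * a2 w 0 * b1 v = U 0 * a2 v 0 * b1 w + Y * c1 v * c2 w"
    and D1: "V 1 * a2 v 0 * c2 w + Y * b2 w 0 * c2 v = D * a2 w 0 * c2 v"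
    and D2: "X * a2 v 0 * c2 w + U 1 * b2 w 0 * c2 v = D * b2 v 0 * c2 w"
    and D3: "D * a2 w 0 * c1 v = U 0 * a2 v 0 * c1 w + Y * b2 w 0 * c1 v"
    and D4: "D * b2 v 0 * c1 w = V 0 * b2 w 0 * c1 v + X * a2 v 0 * c1 w"
    and U_step_b2: "a \<noteq> 0 \<Longrightarrow> U (a + 1) * a1 v * b2 w a = U a * a1 w * b2 v a"
    and U_step_a2: "a \<noteq> 0 \<Longrightarrow> U (a + 1) * a2 w a * b1 v = U a * a2 v a * b1 w"
    and V_step_b2: "a \<noteq> 0 \<Longrightarrow> V (a + 1) * a1 w * b2 v a = V a * a1 v * b2 w a"
    and V_step_a2: "a \<noteq> 0 \<Longrightarrow> V (a + 1) * a2 v a * b1 w = V a * a2 w a * b1 v"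
    and P_a_0: "a \<noteq> 0 \<Longrightarrow> V (a + 1) * a2 v a * c2 w = P a 0 * a2 w a * c2 v"
    and P_0_a: "a \<noteq> 0 \<Longrightarrow> U (a + 1) * b2 w a * c2 v = P 0 a * b2 v a * c2 w"
    and P_a_1: "a \<noteq> 0 \<Longrightarrow> P (a + 1) 1 * b2 v a * c1 w = V a * b2 w a * c1 v"
    and P_1_a: "a \<noteq> 0 \<Longrightarrow> P 1 (a + 1) * a2 w a * c1 v = U a * a2 v a * c1 w"
    and Q_a_0: "a \<noteq> 0 \<Longrightarrow> Q a 0 * a2 w a = Y * b2 w a"
    and Q_0_a: "a \<noteq> 0 \<Longrightarrow> Q 0 a * b2 v a = X * a2 v a"
    and Q_a_1: "a \<noteq> 0 \<Longrightarrow> Q (a + 1) 1 * a2 w a = Y * b2 w a"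
    and Q_1_a: "a \<noteq> 0 \<Longrightarrow> Q 1 (a + 1) * b2 v a = X * a2 v a"
    and P_step_b2: "a \<noteq> b \<Longrightarrow> P (a + 1) (b + 1) * b2 v a * b2 w b = P a b * b2 w a * b2 v b"
    and P_step_a2: "a \<noteq> b \<Longrightarrow> P (a + 1) (b + 1) * a2 v a * a2 w b = P a b * a2 w a * a2 v b"
    and Q_step: "a \<noteq> b \<Longrightarrow> Q (a + 1) (b + 1) = Q a b"

text \<open>Every equation comes from one choice of boundary spins. The instances list them in the
  order top left, bottom left, top, top right, bottom right, bottom; charges on the left are one
  higher because a vertex lowers the charge by one.\<close>

lemma yang_baxter_six_R_imp:
  assumes yb: "yang_baxter (six_R A U V (\<lambda>_. X) (\<lambda>_. Y) P Q) v w"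
    and nz: "nonzero_weights v" "nonzero_weights w" and D: "\<And>a. P a a = D"
  shows "ybe_system A D X Y U V P Q v w"
proof -
  let ?R = "six_R A U V (\<lambda>_. X) (\<lambda>_. Y) P Q"
  have yb: "?R \<beta> \<alpha> \<beta> \<alpha> * column_weight v w \<beta> \<alpha> \<gamma> \<delta> \<epsilon> \<eta> +
      (if \<alpha> = \<beta> then 0 else ?R \<beta> \<alpha> \<alpha> \<beta> * column_weight v w \<alpha> \<beta> \<gamma> \<delta> \<epsilon> \<eta>) =
      column_weight w v \<beta> \<alpha> \<gamma> \<delta> \<epsilon> \<eta> * ?R \<delta> \<epsilon> \<delta> \<epsilon> +
      (if \<epsilon> = \<delta> then 0 else column_weight w v \<beta> \<alpha> \<gamma> \<epsilon> \<delta> \<eta> * ?R \<epsilon> \<delta> \<delta> \<epsilon>)"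
    for \<alpha> \<beta> \<delta> \<epsilon> \<gamma> \<eta>
    using yb unfolding yang_baxter_conserving[OF spin_conserving_six_R] by blast
  note simps = column_weight_def D nz[unfolded nonzero_weights_def] algebra_simps
  show ?thesis
  proof unfold_locales
    show "nonzero_weights v" "nonzero_weights w" "\<And>a. P a a = D"
      by (fact nz D)+
    show "A * b1 v * c2 w = U 0 * b1 w * c2 v + Y * a1 v * c2 w"
      using yb[of DPlus DPlus Minus DPlus "DMinus 0" Plus] by (simp add: simps)
    show "A * a1 w * c2 v = X * b1 w * c2 v + V 0 * a1 v * c2 w"
      using yb[of DPlus DPlus Minus "DMinus 0" DPlus Plus] by (simp add: simps)
    show "V 1 * b1 w * c1 v + Y * a1 v * c1 w = A * b1 v * c1 w"
      using yb[of "DMinus 1" DPlus Plus DPlus DPlus Minus] by (simp add: simps)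
    show "X * b1 w * c1 v + U 1 * a1 v * c1 w = A * a1 w * c1 v"
      using yb[of DPlus "DMinus 1" Plus DPlus DPlus Minus] by (simp add: simps)
    show "V 1 * c1 v * c2 w = U 0 * c1 w * c2 v"
      using yb[of "DMinus 1" DPlus Plus DPlus "DMinus 0" Plus] by (simp add: simps)
    show "U 1 * c1 w * c2 v = V 0 * c1 v * c2 w"
      using yb[of DPlus "DMinus 1" Minus "DMinus 0" DPlus Minus] by (simp add: simps)
    show "V 1 * a1 w * b2 v 0 = V 0 * a1 v * b2 w 0 + X * c1 w * c2 v"
      using yb[of "DMinus 1" DPlus Plus "DMinus 0" DPlus Plus] by (simp add: simps)
    show "U 1 * a1 v * b2 w 0 + X * c1 v * c2 w = U 0 * a1 w * b2 v 0"
      using yb[of DPlus "DMinus 1" Plus DPlus "DMinus 0" Plus] by (simp add: simps)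
    show "V 1 * a2 v 0 * b1 w + Y * c1 w * c2 v = V 0 * a2 w 0 * b1 v"
      using yb[of "DMinus 1" DPlus Minus "DMinus 0" DPlus Minus] by (simp add: simps)
    show "U 1 * a2 w 0 * b1 v = U 0 * a2 v 0 * b1 w + Y * c1 v * c2 w"
      using yb[of DPlus "DMinus 1" Minus DPlus "DMinus 0" Minus] by (simp add: simps)
    show "V 1 * a2 v 0 * c2 w + Y * b2 w 0 * c2 v = D * a2 w 0 * c2 v"
      using yb[of "DMinus 1" DPlus Minus "DMinus 0" "DMinus 0" Plus] by (simp add: simps)
    show "X * a2 v 0 * c2 w + U 1 * b2 w 0 * c2 v = D * b2 v 0 * c2 w"
      using yb[of DPlus "DMinus 1" Minus "DMinus 0" "DMinus 0" Plus] by (simp add: simps)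
    show "D * a2 w 0 * c1 v = U 0 * a2 v 0 * c1 w + Y * b2 w 0 * c1 v"
      using yb[of "DMinus 1" "DMinus 1" Plus DPlus "DMinus 0" Minus] by (simp add: simps)
    show "D * b2 v 0 * c1 w = V 0 * b2 w 0 * c1 v + X * a2 v 0 * c1 w"
      using yb[of "DMinus 1" "DMinus 1" Plus "DMinus 0" DPlus Minus] by (simp add: simps)
  next
    fix a :: "'a mod_ring" assume a: "a \<noteq> 0"
    show "U (a + 1) * a1 v * b2 w a = U a * a1 w * b2 v a"
      using yb[of DPlus "DMinus (a + 1)" Plus DPlus "DMinus a" Plus] a by (simp add: simps)
    show "U (a + 1) * a2 w a * b1 v = U a * a2 v a * b1 w"
      using yb[of DPlus "DMinus (a + 1)" Minus DPlus "DMinus a" Minus] a by (simp add: simps)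
    show "V (a + 1) * a1 w * b2 v a = V a * a1 v * b2 w a"
      using yb[of "DMinus (a + 1)" DPlus Plus "DMinus a" DPlus Plus] a by (simp add: simps)
    show "V (a + 1) * a2 v a * b1 w = V a * a2 w a * b1 v"
      using yb[of "DMinus (a + 1)" DPlus Minus "DMinus a" DPlus Minus] a by (simp add: simps)
    show "V (a + 1) * a2 v a * c2 w = P a 0 * a2 w a * c2 v"
      using yb[of "DMinus (a + 1)" DPlus Minus "DMinus a" "DMinus 0" Plus] a by (simp add: simps)
    show "U (a + 1) * b2 w a * c2 v = P 0 a * b2 v a * c2 w"
      using yb[of DPlus "DMinus (a + 1)" Minus "DMinus 0" "DMinus a" Plus] a by (simp add: simps)
    show "P (a + 1) 1 * b2 v a * c1 w = V a * b2 w a * c1 v"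
      using yb[of "DMinus (a + 1)" "DMinus 1" Plus "DMinus a" DPlus Minus] a by (simp add: simps)
    show "P 1 (a + 1) * a2 w a * c1 v = U a * a2 v a * c1 w"
      using yb[of "DMinus 1" "DMinus (a + 1)" Plus DPlus "DMinus a" Minus] a by (simp add: simps)
    show "Q a 0 * a2 w a = Y * b2 w a"
      using yb[of "DMinus (a + 1)" DPlus Minus "DMinus 0" "DMinus a" Plus] a by (simp add: simps)
    show "Q 0 a * b2 v a = X * a2 v a"
      using yb[of DPlus "DMinus (a + 1)" Minus "DMinus a" "DMinus 0" Plus] a by (simp add: simps)
    show "Q (a + 1) 1 * a2 w a = Y * b2 w a"
      using yb[of "DMinus (a + 1)" "DMinus 1" Plus DPlus "DMinus a" Minus] a by (simp add: simps)
    show "Q 1 (a + 1) * b2 v a = X * a2 v a"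
      using yb[of "DMinus 1" "DMinus (a + 1)" Plus "DMinus a" DPlus Minus] a by (simp add: simps)
  next
    fix a b :: "'a mod_ring" assume ab: "a \<noteq> b"
    show "P (a + 1) (b + 1) * b2 v a * b2 w b = P a b * b2 w a * b2 v b"
      using yb[of "DMinus (a + 1)" "DMinus (b + 1)" Plus "DMinus a" "DMinus b" Plus] ab by (simp add: simps)
    show "P (a + 1) (b + 1) * a2 v a * a2 w b = P a b * a2 w a * a2 v b"
      using yb[of "DMinus (a + 1)" "DMinus (b + 1)" Minus "DMinus a" "DMinus b" Minus] ab by (simp add: simps)
    show "Q (a + 1) (b + 1) = Q a b"
      using yb[of "DMinus (a + 1)" "DMinus (b + 1)" Plus "DMinus b" "DMinus a" Plus] ab by (simp add: simps)
  qed
qed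

lemma yang_baxter_six_RI:
  fixes v w :: "'n::nontriv mod_ring row_weights"
  assumes "ybe_system A D X Y U V P Q v w"
  shows "yang_baxter (six_R A U V (\<lambda>_. X) (\<lambda>_. Y) P Q) v w"
  unfolding yang_baxter_conserving[OF spin_conserving_six_R]
proof (intro allI)
  fix \<alpha> \<beta> \<delta> \<epsilon> :: "'n mod_ring dspin" and \<gamma> \<eta>
  let ?R = "six_R A U V (\<lambda>_. X) (\<lambda>_. Y) P Q"
  \<comment> \<open>Writing the charges on the left as successors makes them directly comparable
    with the charges on the right and matches the form of the equations.\<close>
  have dspin_cases: "x = DPlus \<or> (\<exists>a. x = DMinus (a + 1))" for x :: "'n mod_ring dspin"
    by (cases x) (auto intro: exI[of _ "_ - 1"])
  interpret ybe_system A D X Y U V P Q v w by (fact assms)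
  note s = ybe_system_axioms[unfolded ybe_system_def nonzero_weights_def]
  consider "\<beta> = DPlus" "\<alpha> = DPlus" | b where "\<beta> = DMinus (b + 1)" "\<alpha> = DPlus"
    | a where "\<beta> = DPlus" "\<alpha> = DMinus (a + 1)"
    | a b where "\<beta> = DMinus (b + 1)" "\<alpha> = DMinus (a + 1)"
    using dspin_cases[of \<alpha>] dspin_cases[of \<beta>] by blast
  then show "?R \<beta> \<alpha> \<beta> \<alpha> * column_weight v w \<beta> \<alpha> \<gamma> \<delta> \<epsilon> \<eta> +
      (if \<alpha> = \<beta> then 0 else ?R \<beta> \<alpha> \<alpha> \<beta> * column_weight v w \<alpha> \<beta> \<gamma> \<delta> \<epsilon> \<eta>) =
      column_weight w v \<beta> \<alpha> \<gamma> \<delta> \<epsilon> \<eta> * ?R \<delta> \<epsilon> \<delta> \<epsilon> +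
      (if \<epsilon> = \<delta> then 0 else column_weight w v \<beta> \<alpha> \<gamma> \<epsilon> \<delta> \<eta> * ?R \<epsilon> \<delta> \<delta> \<epsilon>)"
  proof cases
    case 1
    then show ?thesis
      using s by (cases \<delta>; cases \<epsilon>; cases \<gamma>; cases \<eta>; hypsubst)
        (auto simp: column_weight_def P_diag algebra_simps)
  next
    case 2
    then show ?thesis
      using s by (cases \<delta>; cases \<epsilon>; cases \<gamma>; cases \<eta>; hypsubst)
        (auto simp: column_weight_def P_diag algebra_simps)
  next
    case 3
    then show ?thesis
      using s by (cases \<delta>; cases \<epsilon>; cases \<gamma>; cases \<eta>; hypsubst)
        (auto simp: column_weight_def P_diag algebra_simps)
  next
    case 4
    then show ?thesis
      using s by (cases \<delta>; cases \<epsilon>; cases \<gamma>; cases \<eta>; hypsubst)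
        (auto simp: column_weight_def P_diag algebra_simps)
  qed
qed

section \<open>Recursions around the cyclic group of charges\<close>

text \<open>The position of a charge in the order \<open>1, 2, \<dots>, n - 1, 0\<close>. The recursions that relate the charges
  \<open>a\<close> and \<open>a + 1\<close> hold only for \<open>a \<noteq> 0\<close>, so they run along this order without wrapping around.\<close>

definition charge_index :: "'n::nontriv mod_ring \<Rightarrow> nat" where
  "charge_index a = nat (to_int_mod_ring (a - 1))"

lemma to_int_mod_ring_bounds:
  "0 \<le> to_int_mod_ring a" "to_int_mod_ring a < int CARD('n)" for a :: "'n::finite mod_ring"
  using range_to_int_mod_ring[where 'a = 'n] rangeI[of to_int_mod_ring a] by auto

lemma of_nat_nat_to_int_mod_ring: "of_nat (nat (to_int_mod_ring a)) = (a :: 'n::nontriv mod_ring)"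
  by (simp add: of_nat_of_int_mod_ring to_int_mod_ring_bounds)

lemma of_nat_mod_ring_inject:
  assumes "i < CARD('n)" "j < CARD('n)" "of_nat i = (of_nat j :: 'n::nontriv mod_ring)"
  shows "i = j"
proof -
  have *: "to_int_mod_ring (of_nat k :: 'n mod_ring) = int k" if "k < CARD('n)" for k
    using that by (simp add: of_nat_of_int_mod_ring)
  have "int i = to_int_mod_ring (of_nat i :: 'n mod_ring)"
    by (simp only: *[OF assms(1)])
  also have "\<dots> = int j"
    by (simp only: assms(3) *[OF assms(2)])
  finally show ?thesis by simp
qed

lemma charge_index_less: "charge_index (a :: 'n::nontriv mod_ring) < CARD('n)"
  using to_int_mod_ring_bounds[of "a - 1"] by (simp add: charge_index_def nat_less_iff)

lemma of_nat_charge_index: "of_nat (charge_index a) = a - 1"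
  by (simp add: charge_index_def of_nat_nat_to_int_mod_ring)

lemma charge_index_eqI:
  assumes "k < CARD('n)" "of_nat k = (a :: 'n::nontriv mod_ring) - 1"
  shows "charge_index a = k"
  by (rule of_nat_mod_ring_inject[OF charge_index_less assms(1)]) (simp add: of_nat_charge_index assms(2))

lemma charge_index_inject:
  fixes a b :: "'n::nontriv mod_ring"
  assumes "charge_index a = charge_index b"
  shows "a = b"
proof -
  have "of_nat (charge_index a) = (of_nat (charge_index b) :: 'n mod_ring)"
    by (simp only: assms)
  then show ?thesis
    unfolding of_nat_charge_index by simp
qed

lemma charge_index_1 [simp]: "charge_index 1 = 0"
  by (rule charge_index_eqI) auto

lemma charge_index_0: "charge_index (0 :: 'n::nontriv mod_ring) = CARD('n) - 1"
proof (rule charge_index_eqI)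
  have "of_nat (Suc (CARD('n) - 1)) = (0 :: 'n mod_ring)"
    by (simp del: of_nat_Suc)
  then show "of_nat (CARD('n) - 1) = (0 :: 'n mod_ring) - 1"
    by (simp add: eq_neg_iff_add_eq_0 add.commute)
qed simp

lemma charge_index_less_0:
  fixes a :: "'n::nontriv mod_ring"
  assumes "a \<noteq> 0"
  shows "charge_index a < charge_index (0 :: 'n mod_ring)"
proof -
  have "charge_index a \<noteq> charge_index (0 :: 'n mod_ring)"
    using charge_index_inject assms by blast
  then show ?thesis
    using charge_index_less[of a] by (simp add: charge_index_0)
qed

lemma charge_index_plus_1:
  assumes "a \<noteq> (0 :: 'n::nontriv mod_ring)"
  shows "charge_index (a + 1) = Suc (charge_index a)"
proof (rule charge_index_eqI)
  show "Suc (charge_index a) < CARD('n)"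
    using charge_index_less_0[OF assms] by (simp add: charge_index_0)
qed (simp add: of_nat_charge_index)

text \<open>Induction on \<open>charge_index\<close>: the order starts at \<open>1\<close> and
  reaches \<open>0\<close> last, so every step starts from a nonzero charge.\<close>

lemma mod_ring_cyclic_induct:
  fixes a :: "'n::nontriv mod_ring"
  assumes "P 1" and step: "\<And>a. a \<noteq> 0 \<Longrightarrow> P a \<Longrightarrow> P (a + 1)"
  shows "P a"
proof (induction "charge_index a" arbitrary: a)
  case 0
  then have "a = 1"
    using charge_index_inject[of a 1] by simp
  with assms show ?case by simp
next
  case (Suc k)
  have *: "of_nat k = (a - 1) - 1"
    using of_nat_charge_index[of a] by (simp add: Suc.hyps(2)[symmetric] algebra_simps)
  have "charge_index (a - 1) = k"
    by (rule charge_index_eqI[OF _ *]) (use charge_index_less[of a] Suc.hyps(2) in simp)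
  moreover have "a - 1 \<noteq> 0"
    using Suc.hyps(2) by auto
  ultimately show ?case
    using step[of "a - 1"] Suc.hyps(1)[of "a - 1"] by simp
qed

lemma mod_ring_constantI:
  fixes f :: "'n::nontriv mod_ring \<Rightarrow> 'b"
  assumes "\<And>a. f (a + 1) = f a"
  shows "f a = f b"
proof -
  have "f a = f 1" for a
    by (induction a rule: mod_ring_cyclic_induct) (simp_all add: assms)
  then show ?thesis by metis
qed

lemma ex_cyclic_recurrence:
  fixes h :: "'n::nontriv mod_ring \<Rightarrow> 'b::field"
  assumes "\<And>a. h a \<noteq> 0"
  obtains U where "U 1 = 1" "\<And>a. U a \<noteq> 0" "\<And>a. a \<noteq> 0 \<Longrightarrow> U (a + 1) = h a * U a"
\<comment> \<open>The charge in position \<open>p\<close> is \<open>of_nat p + 1\<close>, so the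
  witness multiplies \<open>h\<close> over all charges that precede \<open>a\<close>.\<close>
proof (rule that[of "\<lambda>a :: 'n mod_ring. \<Prod>p<charge_index a. h (of_nat p + 1)"])
qed (simp_all add: assms charge_index_plus_1 of_nat_charge_index)

lemma prod_of_nat_mod_ring:
  "(\<Prod>p<CARD('n). f (of_nat p :: 'n::nontriv mod_ring)) = prod f UNIV"
proof (rule prod.reindex_bij_betw)
  show "bij_betw (of_nat :: nat \<Rightarrow> 'n mod_ring) {..<CARD('n)} UNIV"
    unfolding bij_betw_def
  proof
    show "inj_on (of_nat :: nat \<Rightarrow> 'n mod_ring) {..<CARD('n)}"
      by (auto intro!: inj_onI dest: of_nat_mod_ring_inject)
    show "of_nat ` {..<CARD('n)} = (UNIV :: 'n mod_ring set)"
    proof (intro equalityI subsetI)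
      fix a :: "'n mod_ring"
      show "a \<in> of_nat ` {..<CARD('n)}"
        using of_nat_charge_index[of "a + 1"] charge_index_less[of "a + 1"]
        by (intro image_eqI[of _ _ "charge_index (a + 1)"]) auto
    qed simp
  qed
qed

text \<open>Multiplying the recurrence over all nonzero charges telescopes: the products of
  \<open>U\<close> differ only in that one lacks \<open>U 1\<close> and the other
  \<open>U 0\<close>. Equality of the full products thus amounts to the one remaining step, from
  \<open>0\<close> to \<open>1\<close>.\<close>

lemma cyclic_recurrence_prod_eq_iff:
  fixes U f g :: "'n::nontriv mod_ring \<Rightarrow> 'b::field"
  assumes rec: "\<And>a. a \<noteq> 0 \<Longrightarrow> U (a + 1) * f a = U a * g a"
    and nz: "\<And>a. U a \<noteq> 0" "\<And>a. f a \<noteq> 0" "\<And>a. g a \<noteq> 0"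
  shows "prod f UNIV = prod g UNIV \<longleftrightarrow> U 0 * g 0 = U 1 * f 0"
proof -
  have remove: "prod h UNIV = h c * prod h (UNIV - {c})" for h and c :: "'n mod_ring"
    by (rule prod.remove) auto
  have "(\<Prod>a\<in>UNIV - {0}. U (a + 1)) = prod U (UNIV - {1})"
    by (rule prod.reindex_bij_witness[of _ "\<lambda>a. a - 1" "\<lambda>a. a + 1"]) auto
  moreover have "(\<Prod>a\<in>UNIV - {0}. U (a + 1) * f a) = (\<Prod>a\<in>UNIV - {0}. U a * g a)"
    by (rule prod.cong) (auto simp: rec)
  ultimately have "prod U (UNIV - {1}) * prod f (UNIV - {0}) =
      prod U (UNIV - {0}) * prod g (UNIV - {0})"
    by (simp add: prod.distrib)
  then have "U 0 * (U 1 * prod U (UNIV - {1})) * prod f (UNIV - {0}) =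
      U 1 * (U 0 * prod U (UNIV - {0})) * prod g (UNIV - {0})"
    by (simp add: mult_ac)
  then have eq: "U 0 * prod f (UNIV - {0}) = U 1 * prod g (UNIV - {0})"
    using nz(1) by (simp add: mult_ac flip: remove)
  have "prod f UNIV = prod g UNIV \<longleftrightarrow>
      U 0 * (f 0 * prod f (UNIV - {0})) = U 0 * (g 0 * prod g (UNIV - {0}))"
    using nz(1) by (simp flip: remove)
  also have "\<dots> \<longleftrightarrow> (U 1 * f 0) * prod g (UNIV - {0}) = (U 0 * g 0) * prod g (UNIV - {0})"
    unfolding mult.left_commute[of "U 0" "f 0"] eq by (simp only: mult_ac)
  also have "\<dots> \<longleftrightarrow> U 0 * g 0 = U 1 * f 0"
    using nz(3) by auto
  finally show ?thesis .
qed

text \<open>The letters \<open>p\<close>, \<open>q\<close>, \<open>r\<close> stand for the a-, b-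
  and c-weights, primes for the second row. Comparing the two equations for \<open>A\<close>
  eliminates it; the equations \<open>X\<close>, \<open>Y\<close> and \<open>V\<close> then
  eliminate the exchange weights and \<open>V0\<close>. What remains are the free fermion
  expressions of the two rows.\<close>

lemma conserving_identity:
  fixes A X Y U0 U1 V0 p1 p2 q1 q2 r1 r2 p1' p2' q1' q2' r1' r2' :: complex
  assumes A: "A * q1 * r2' = U0 * q1' * r2 + Y * p1 * r2'" "A * p1' * r2 = X * q1' * r2 + V0 * p1 * r2'"
    and V: "U1 * r1' * r2 = V0 * r1 * r2'"
    and X: "U1 * p1 * q2' + X * r1 * r2' = U0 * p1' * q2"
    and Y: "U1 * p2' * q1 = U0 * p2 * q1' + Y * r1 * r2'" and "r2 \<noteq> 0"
  shows "U0 * p1' * q1' * (p1 * p2 + q1 * q2 - r1 * r2) = U1 * p1 * q1 * (p1' * p2' + q1' * q2' - r1' * r2')"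
proof -
  have "p1' * r2 * (A * q1 * r2') = q1 * r2' * (A * p1' * r2)" by simp
  then have "r1 * (p1' * r2 * (U0 * q1' * r2 + Y * p1 * r2')) = r1 * (q1 * r2' * (X * q1' * r2 + V0 * p1 * r2'))"
    unfolding A by (rule arg_cong)
  then have "r1 * p1' * r2 * U0 * q1' * r2 + p1' * r2 * p1 * (Y * r1 * r2') =
      q1 * q1' * r2 * (X * r1 * r2') + q1 * p1 * r2' * (V0 * r1 * r2')"
    by (simp add: algebra_simps)
  note * = this
  have "X * r1 * r2' = U0 * p1' * q2 - U1 * p1 * q2'" "Y * r1 * r2' = U1 * p2' * q1 - U0 * p2 * q1'"
    using X Y by (simp_all add: algebra_simps)
  note * = *[unfolded this V[symmetric]]
  have "r2 * (U0 * p1' * q1' * (p1 * p2 + q1 * q2 - r1 * r2)) =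
      r2 * (U1 * p1 * q1 * (p1' * p2' + q1' * q2' - r1' * r2'))"
    using * by (simp add: algebra_simps)
  with \<open>r2 \<noteq> 0\<close> show ?thesis by simp
qed

section \<open>Solvable pairs of rows\<close>

text \<open>A simultaneous shift keeps the difference of the charges, so the step applies all the
  way around the cycle.\<close>

lemma diagonal_shift_invariant:
  fixes F :: "'n::nontriv mod_ring \<Rightarrow> 'n mod_ring \<Rightarrow> 'b"
  assumes step: "\<And>a b. a \<noteq> b \<Longrightarrow> F (a + 1) (b + 1) = F a b" and "a \<noteq> b"
  shows "F a b = F (a - b) 0"
proof -
  have "F (a + (c + 1)) (b + (c + 1)) = F (a + c) (b + c)" for c
    using step[of "a + c" "b + c"] \<open>a \<noteq> b\<close> by (simp add: add.assoc)
  from mod_ring_constantI[of "\<lambda>c. F (a + c) (b + c)", OF this, of 0 "- b"]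
  show ?thesis by simp
qed

definition ratio :: "'n::nontriv mod_ring row_weights \<Rightarrow> 'n mod_ring \<Rightarrow> complex" where
  "ratio w a = a1 w * a2 w a / (b1 w * b2 w a)"

text \<open>The expression whose vanishing is the free fermion condition at charge
  \<open>0\<close>.\<close>

definition defect :: "'n::nontriv mod_ring row_weights \<Rightarrow> complex" where
  "defect w = a1 w * a2 w 0 + b1 w * b2 w 0 - c1 w * c2 w"

text \<open>The solvability criterion for one pair of rows. Equality of the quotients by
  \<open>c1 * c2\<close> is written without denominators. The free fermion condition is stated for
  \<open>v\<close> alone, since the equalities before it carry it over to \<open>w\<close>.\<close>

definition compatible ::
  "'n::nontriv mod_ring row_weights \<Rightarrow> 'n mod_ring row_weights \<Rightarrow> bool" where
  "compatible v w \<longleftrightarrow> ratio v = ratio w \<and>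
    c1 v * c2 v * (b1 w * b2 w 0) = c1 w * c2 w * (b1 v * b2 v 0) \<and>
    ((\<Prod>a\<in>UNIV. a1 v * b2 w a) = (\<Prod>a\<in>UNIV. a1 w * b2 v a) \<or>
     defect v = 0 \<and> metaplectic (ratio v))"

text \<open>Each exchange weight, times \<open>r1 * r2'\<close>, is the difference of two products
  of weights. Replacing products of a-weights by \<open>g\<close> times products of b-weights makes
  the two differences proportional.\<close>

lemma twist_relation:
  fixes X Y U0 U1 g p1 p2 q1 q2 p1' p2' q1' q2' r1 r2' :: complex
  assumes X: "U1 * p1 * q2' + X * r1 * r2' = U0 * p1' * q2"
    and Y: "U1 * p2' * q1 = U0 * p2 * q1' + Y * r1 * r2'"
    and p: "p1 * p2 = g * (q1 * q2)" "p1' * p2' = g * (q1' * q2')" and "r1 \<noteq> 0" "r2' \<noteq> 0"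
  shows "Y * (p1 * p1') = - g * X * (q1 * q1')"
proof -
  have "Y * (p1 * p1') * (r1 * r2') = (Y * r1 * r2') * (p1 * p1')"
    by (simp only: mult_ac)
  also have "Y * r1 * r2' = U1 * p2' * q1 - U0 * p2 * q1'"
    using Y by simp
  also have "\<dots> * (p1 * p1') = U1 * p1 * q1 * (p1' * p2') - U0 * p1' * q1' * (p1 * p2)"
    by (simp add: algebra_simps)
  also have "\<dots> = - g * (q1 * q1') * (U0 * p1' * q2 - U1 * p1 * q2')"
    unfolding p by (simp add: algebra_simps)
  also have "U0 * p1' * q2 - U1 * p1 * q2' = X * r1 * r2'"
    using X by (simp add: algebra_simps)
  finally have "Y * (p1 * p1') * (r1 * r2') = - g * X * (q1 * q1') * (r1 * r2')"
    by (simp only: mult_ac)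
  then show ?thesis
    using assms(5,6) by (simp only: mult_cancel_right) simp
qed

section \<open>Necessity: relations forced by the equations\<close>

context ybe_system
begin

lemma weights_nonzero [simp]:
  "a1 v \<noteq> 0" "a2 v a \<noteq> 0" "b1 v \<noteq> 0" "b2 v a \<noteq> 0" "c1 v \<noteq> 0" "c2 v \<noteq> 0"
  "a1 w \<noteq> 0" "a2 w a \<noteq> 0" "b1 w \<noteq> 0" "b2 w a \<noteq> 0" "c1 w \<noteq> 0" "c2 w \<noteq> 0"
  using nonzero_v nonzero_w by (simp_all add: nonzero_weights_def)

lemma U_eq_0:
  assumes "U 1 = 0"
  shows "U a = 0"
proof (induction a rule: mod_ring_cyclic_induct)
  case (2 a)
  then show ?case using U_step_b2[of a] by simp
qed (fact assms)

lemma V_eq_0: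
  assumes "U 1 = 0"
  shows "V a = 0"
proof (induction a rule: mod_ring_cyclic_induct)
  case 1
  then show ?case using V1_U0 U_eq_0[OF assms, of 0] by simp
next
  case (2 a)
  then show ?case using V_step_b2[of a] by simp
qed

text \<open>The zero spreads through all entries: along the recursions to \<open>U\<close> and
  \<open>V\<close>, then to \<open>X\<close>, \<open>A\<close>, \<open>Y\<close> and
  \<open>D\<close>. Off the diagonal, \<open>P\<close> and \<open>Q\<close> are controlled by their
  values at \<open>(a - b, 0)\<close>, which vanish too. A nonzero weight therefore has
  \<open>U 1 \<noteq> 0\<close>.\<close>

lemma six_R_eq_0:
  assumes "U 1 = 0"
  shows "six_R A U V (\<lambda>_. X) (\<lambda>_. Y) P Q x y z t = 0"
proof -
  note [simp] = U_eq_0[OF assms] V_eq_0[OF assms]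
  have X: "X = 0" using U_wrap_b2 by simp
  then have A: "A = 0" using A2 by simp
  then have Y: "Y = 0" using A1 by simp
  then have D: "D = 0" using D1 by simp
  \<comment> \<open>The step multiplies \<open>P\<close> by a nonzero factor, so what is invariant
    under shifts is the truth of \<open>P a b = 0\<close>.\<close>
  have P_shift: "(P a b = 0) = (P (a - b) 0 = 0)" if "a \<noteq> b" for a b
  proof (rule diagonal_shift_invariant[OF _ that])
    show "(P (a + 1) (b + 1) = 0) = (P a b = 0)" if "a \<noteq> b" for a b
      using P_step_b2[OF that] by (cases "P a b = 0") auto
  qed
  have P: "P a b = 0" for a b
  proof (cases "a = b")
    case True
    then show ?thesis using P_diag D by simp
  next
    case False
    then have "P (a - b) 0 = 0"
      using P_a_0[of "a - b"] by simp
    then show ?thesis by (simp only: P_shift[OF False])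
  qed
  have Q: "a = b" if "Q a b \<noteq> 0" for a b
  proof (rule ccontr)
    assume "a \<noteq> b"
    moreover have "Q a b = Q (a - b) 0"
      by (rule diagonal_shift_invariant[of Q, OF Q_step \<open>a \<noteq> b\<close>])
    ultimately show False
      using Q_a_0[of "a - b"] Y that by simp
  qed
  show ?thesis
  proof (rule ccontr)
    assume "six_R A U V (\<lambda>_. X) (\<lambda>_. Y) P Q x y z t \<noteq> 0"
    then show False
      by (cases x; cases y; cases z; cases t) (auto simp: A X Y P dest: Q split: if_splits)
  qed
qed

lemma U_nonzero:
  assumes "U 1 \<noteq> 0"
  shows "U a \<noteq> 0"
proof (induction a rule: mod_ring_cyclic_induct)
  case (2 a)
  show ?case
  proof
    assume "U (a + 1) = 0"
    with U_step_b2[OF 2(1)] 2(2) show False by simp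
  qed
qed (fact assms)

text \<open>The quotient of \<open>U (a + 1)\<close> by \<open>U a\<close> is given once through
  \<open>b2\<close> and once through \<open>a2\<close>; the two must agree.\<close>

lemma ratio_cross_nonzero:
  assumes "U 1 \<noteq> 0" "a \<noteq> 0"
  shows "a1 v * a2 v a * (b1 w * b2 w a) = a1 w * a2 w a * (b1 v * b2 v a)"
proof -
  have "(U (a + 1) * a1 v * b2 w a) * (U a * a2 v a * b1 w) =
      (U a * a1 w * b2 v a) * (U (a + 1) * a2 w a * b1 v)"
    by (simp only: U_step_b2[OF assms(2)] U_step_a2[OF assms(2)])
  then have "(U (a + 1) * U a) * (a1 v * a2 v a * (b1 w * b2 w a)) =
      (U (a + 1) * U a) * (a1 w * a2 w a * (b1 v * b2 v a))"
    by (simp only: mult_ac)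
  then show ?thesis
    using U_nonzero[OF assms(1)] by (simp only: mult_cancel_left) simp
qed

text \<open>At charge \<open>0\<close> the recursion for \<open>U\<close> has an exchange term, so
  \<open>P\<close> takes its place: the shift from \<open>P 0 1\<close> to
  \<open>P 1 (1 + 1)\<close>, computed through \<open>a2\<close> and through \<open>b2\<close>,
  transfers the relation from charge \<open>1\<close> to charge \<open>0\<close>.\<close>

lemma ratio_cross:
  assumes U1: "U 1 \<noteq> 0"
  shows "a1 v * a2 v a * (b1 w * b2 w a) = a1 w * a2 w a * (b1 v * b2 v a)"
proof (cases "a = 0")
  case True
  have P01: "P 0 1 \<noteq> 0"
  proof
    assume "P 0 1 = 0"
    with P_0_a[of 1] U_nonzero[OF U1, of "1 + 1"] show False by simp
  qed
  have P12: "P 1 (1 + 1) \<noteq> 0"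
  proof
    assume "P 1 (1 + 1) = 0"
    with P_1_a[of 1] U1 show False by simp
  qed
  have b: "P 1 (1 + 1) * b2 v 0 * b2 w 1 = P 0 1 * b2 w 0 * b2 v 1"
    and a: "P 1 (1 + 1) * a2 v 0 * a2 w 1 = P 0 1 * a2 w 0 * a2 v 1"
    using P_step_b2[of 0 1] P_step_a2[of 0 1] by simp_all
  have "(P 1 (1 + 1) * a2 v 0 * a2 w 1) * (P 0 1 * b2 w 0 * b2 v 1) *
      (a1 v * a2 v 1 * (b1 w * b2 w 1)) * (a1 v * b1 w * a1 w * b1 v) =
      (P 0 1 * a2 w 0 * a2 v 1) * (P 1 (1 + 1) * b2 v 0 * b2 w 1) *
      (a1 w * a2 w 1 * (b1 v * b2 v 1)) * (a1 v * b1 w * a1 w * b1 v)"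
    unfolding a b ratio_cross_nonzero[OF U1 one_neq_zero] by (rule refl)
  then have "(P 1 (1 + 1) * P 0 1 * a1 v * b1 w * a1 w * b1 v * a2 w 1 * b2 v 1 * a2 v 1 * b2 w 1) *
      (a1 v * a2 v 0 * (b1 w * b2 w 0)) =
      (P 1 (1 + 1) * P 0 1 * a1 v * b1 w * a1 w * b1 v * a2 w 1 * b2 v 1 * a2 v 1 * b2 w 1) *
      (a1 w * a2 w 0 * (b1 v * b2 v 0))"
    by (simp only: mult_ac)
  then have "a1 v * a2 v 0 * (b1 w * b2 w 0) = a1 w * a2 w 0 * (b1 v * b2 v 0)"
    using P01 P12 by (simp only: mult_cancel_left) simp
  with True show ?thesis by simp
qed (rule ratio_cross_nonzero[OF assms])

text \<open>The entries \<open>P 0 1\<close> and \<open>P 1 (1 + 1)\<close> are tied to each other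
  directly by a shift, and also by way of \<open>U (1 + 1)\<close> and \<open>U 1\<close> through
  equations with c-weights. Comparing the two routes leaves the relation.\<close>

lemma c_cross:
  assumes U1: "U 1 \<noteq> 0"
  shows "c1 v * c2 v * (b1 w * b2 w 0) = c1 w * c2 w * (b1 v * b2 v 0)"
proof -
  have P01: "P 0 1 \<noteq> 0"
  proof
    assume "P 0 1 = 0"
    with P_0_a[of 1] U_nonzero[OF U1, of "1 + 1"] show False by simp
  qed
  have P12: "P 1 (1 + 1) \<noteq> 0"
  proof
    assume "P 1 (1 + 1) = 0"
    with P_1_a[of 1] U1 show False by simp
  qed
  have b: "P 1 (1 + 1) * b2 v 0 * b2 w 1 = P 0 1 * b2 w 0 * b2 v 1"
    using P_step_b2[of 0 1] by simp
  have "(U (1 + 1) * b2 w 1 * c2 v) * (P 1 (1 + 1) * a2 w 1 * c1 v) * (U 1 * a2 v 1 * b1 w) *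
      (P 0 1 * b2 w 0 * b2 v 1) =
      (P 0 1 * b2 v 1 * c2 w) * (U 1 * a2 v 1 * c1 w) * (U (1 + 1) * a2 w 1 * b1 v) *
      (P 1 (1 + 1) * b2 v 0 * b2 w 1)"
    unfolding P_0_a[OF one_neq_zero] P_1_a[OF one_neq_zero] U_step_a2[OF one_neq_zero] b by (rule refl)
  then have "(U (1 + 1) * P 1 (1 + 1) * U 1 * P 0 1 * b2 w 1 * a2 w 1 * a2 v 1 * b2 v 1) *
      (c1 v * c2 v * (b1 w * b2 w 0)) =
      (U (1 + 1) * P 1 (1 + 1) * U 1 * P 0 1 * b2 w 1 * a2 w 1 * a2 v 1 * b2 v 1) *
      (c1 w * c2 w * (b1 v * b2 v 0))"
    by (simp only: mult_ac)
  then show ?thesis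
    using P01 P12 U_nonzero[OF U1, of "1 + 1"] U1 by (simp only: mult_cancel_left) simp
qed

lemma a2_v_eq: "a1 v * a2 v a = ratio v a * (b1 v * b2 v a)"
  by (simp add: ratio_def)

lemma a2_w_eq:
  assumes "U 1 \<noteq> 0"
  shows "a1 w * a2 w a = ratio v a * (b1 w * b2 w a)"
  using ratio_cross[OF assms, of a] by (simp add: ratio_def field_simps)

lemma ratio_eq:
  assumes "U 1 \<noteq> 0"
  shows "ratio v = ratio w"
  using a2_w_eq[OF assms] by (auto simp: ratio_def fun_eq_iff)

lemma Y_eq:
  assumes "U 1 \<noteq> 0"
  shows "Y * (a1 v * a1 w) = - ratio v 0 * X * (b1 v * b1 w)"
  by (rule twist_relation[OF U_wrap_b2 U_wrap_a2 a2_v_eq a2_w_eq[OF assms]]) simp_all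

text \<open>Since \<open>Q\<close> depends only on the difference of the charges,
  \<open>Q a 0 = Q 0 (- a)\<close>. The first is a multiple of \<open>Y\<close>, the second of
  \<open>X\<close>, and \<open>Y_eq\<close> relates these by the factor
  \<open>- ratio v 0\<close>.\<close>

lemma metaplectic_ratio:
  assumes "U 1 \<noteq> 0" "X \<noteq> 0"
  shows "metaplectic (ratio v)"
  unfolding metaplectic_def
proof (intro conjI allI impI)
  show "ratio v a \<noteq> 0" for a by (simp add: ratio_def)
  fix a :: "'n mod_ring"
  assume a: "a \<noteq> 0"
  then have na: "- a \<noteq> 0" by simp
  have "Q a 0 = Q 0 (- a)"
    using diagonal_shift_invariant[of Q, OF Q_step, of 0 "- a"] a by simp
  then have "(Q a 0 * a2 w a) * b2 v (- a) = (Q 0 (- a) * b2 v (- a)) * a2 w a"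
    by (simp only: mult_ac)
  then have *: "(Y * b2 w a) * b2 v (- a) = (X * a2 v (- a)) * a2 w a"
    unfolding Q_a_0[OF a] Q_0_a[OF na] .
  have "(Y * (a1 v * a1 w)) * (b2 w a * b2 v (- a)) =
      (a1 v * a1 w) * ((Y * b2 w a) * b2 v (- a))"
    by (simp only: mult_ac)
  also have "\<dots> = X * (a1 v * a2 v (- a)) * (a1 w * a2 w a)"
    unfolding * by (simp only: mult_ac)
  finally have "(Y * (a1 v * a1 w)) * (b2 w a * b2 v (- a)) =
      X * (a1 v * a2 v (- a)) * (a1 w * a2 w a)" .
  then have "(X * (b1 v * b1 w) * (b2 w a * b2 v (- a))) * (- ratio v 0) =
      (X * (b1 v * b1 w) * (b2 w a * b2 v (- a))) * (ratio v a * ratio v (- a))"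
    unfolding Y_eq[OF assms(1)] a2_v_eq a2_w_eq[OF assms(1)] by (simp only: mult_ac)
  then show "ratio v a * ratio v (- a) = - ratio v 0"
    using assms(2) by (simp only: mult_cancel_left) simp
qed

text \<open>The products agree exactly when the recursion for \<open>U\<close> also holds at charge
  \<open>0\<close>; \<open>U_wrap_b2\<close> shows that its failure there is a nonzero multiple of
  \<open>X\<close>.\<close>

lemma prod_eq_iff:
  assumes "U 1 \<noteq> 0"
  shows "(\<Prod>a\<in>UNIV. a1 v * b2 w a) = (\<Prod>a\<in>UNIV. a1 w * b2 v a) \<longleftrightarrow> X = 0"
proof -
  have "(\<Prod>a\<in>UNIV. a1 v * b2 w a) = (\<Prod>a\<in>UNIV. a1 w * b2 v a) \<longleftrightarrow>
      U 0 * (a1 w * b2 v 0) = U 1 * (a1 v * b2 w 0)"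
    by (rule cyclic_recurrence_prod_eq_iff)
      (use U_step_b2 U_nonzero[OF assms] in \<open>auto simp: mult.assoc\<close>)
  also have "\<dots> \<longleftrightarrow> X = 0"
    using U_wrap_b2 by (auto simp: mult.assoc)
  finally show ?thesis .
qed

lemma defect_cross:
  assumes "U 1 \<noteq> 0"
  shows "defect v * (b1 w * b2 w 0) = defect w * (b1 v * b2 v 0)"
  using ratio_cross[OF assms, of 0] c_cross[OF assms]
  by (simp add: defect_def algebra_simps)

text \<open>Eliminating \<open>A\<close> relates the two defects through \<open>U 0\<close> and
  \<open>U 1\<close>, while \<open>defect_cross\<close> relates them without \<open>U\<close>. If
  they do not vanish, they cancel and leave the equation \<open>U_wrap_b2\<close> without its
  exchange term.\<close>

lemma X_eq_0:
  assumes U1: "U 1 \<noteq> 0" and d: "defect v \<noteq> 0"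
  shows "X = 0"
proof -
  have dw: "defect w \<noteq> 0"
  proof
    assume "defect w = 0"
    with defect_cross[OF U1] d show False by simp
  qed
  have "U 0 * a1 w * b1 w * defect v = U 1 * a1 v * b1 v * defect w"
    unfolding defect_def
    by (rule conserving_identity[OF A1 A2 U1_V0 U_wrap_b2 U_wrap_a2]) simp
  then have "U 0 * a1 w * (defect v * (b1 w * b2 w 0)) = U 1 * a1 v * b1 v * defect w * b2 w 0"
    by (metis mult.assoc mult.commute)
  then have "(b1 v * defect w) * (U 0 * a1 w * b2 v 0) = (b1 v * defect w) * (U 1 * a1 v * b2 w 0)"
    unfolding defect_cross[OF U1] by (simp only: mult_ac)
  then have "U 0 * a1 w * b2 v 0 = U 1 * a1 v * b2 w 0"
    using dw by (simp only: mult_cancel_left) simp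
  with U_wrap_b2 show ?thesis by simp
qed

lemma compatible_weights:
  assumes "U 1 \<noteq> 0"
  shows "compatible v w"
  unfolding compatible_def prod_eq_iff[OF assms]
  using ratio_eq[OF assms] c_cross[OF assms] X_eq_0[OF assms] metaplectic_ratio[OF assms]
  by blast

end

lemma yang_baxter_imp_compatible:
  fixes v w :: "'n::nontriv mod_ring row_weights"
  assumes nz: "nonzero_weights v" "nonzero_weights w"
    and R: "spin_conserving R" "R x y z t \<noteq> 0" "yang_baxter R v w"
  shows "compatible v w"
proof -
  obtain A U V X Y P Q where R_eq: "R = six_R A U V X Y P Q"
    using conserving_eq_six_R[OF R(1)] by blast
  have yb: "R \<beta> \<alpha> \<beta> \<alpha> * column_weight v w \<beta> \<alpha> \<gamma> \<delta> \<epsilon> \<eta> +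
      (if \<alpha> = \<beta> then 0 else R \<beta> \<alpha> \<alpha> \<beta> * column_weight v w \<alpha> \<beta> \<gamma> \<delta> \<epsilon> \<eta>) =
      column_weight w v \<beta> \<alpha> \<gamma> \<delta> \<epsilon> \<eta> * R \<delta> \<epsilon> \<delta> \<epsilon> +
      (if \<epsilon> = \<delta> then 0 else column_weight w v \<beta> \<alpha> \<gamma> \<epsilon> \<delta> \<eta> * R \<epsilon> \<delta> \<delta> \<epsilon>)"
    for \<alpha> \<beta> \<delta> \<epsilon> \<gamma> \<eta>
    using R(3) unfolding yang_baxter_conserving[OF R(1)] by blast
  \<comment> \<open>In this component, and in those used next for \<open>Y\<close> and the diagonal
    of \<open>P\<close>, both sides carry the same nonzero vertex weights, which cancel.\<close>
  have "X (a + 1) = X a" for a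
    using yb[of DPlus "DMinus (a + 1)" Plus "DMinus a" DPlus Plus] nz
    by (simp add: R_eq column_weight_def nonzero_weights_def split: if_splits)
  then have X: "X a = X 0" for a by (rule mod_ring_constantI)
  have "Y (a + 1) = Y a" for a
    using yb[of "DMinus (a + 1)" DPlus Minus DPlus "DMinus a" Minus] nz
    by (simp add: R_eq column_weight_def nonzero_weights_def split: if_splits)
  then have Y: "Y a = Y 0" for a by (rule mod_ring_constantI)
  have "P (a + 1) (a + 1) = P a a" for a
    using yb[of "DMinus (a + 1)" "DMinus (a + 1)" Plus "DMinus a" "DMinus a" Plus] nz
    by (simp add: R_eq column_weight_def nonzero_weights_def split: if_splits)
  then have P: "P a a = P 0 0" for a by (rule mod_ring_constantI[of "\<lambda>a. P a a"])
  have R_eq: "R = six_R A U V (\<lambda>_. X 0) (\<lambda>_. Y 0) P Q"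
    unfolding R_eq using X Y by (metis ext)
  interpret ybe_system A "P 0 0" "X 0" "Y 0" U V P Q v w
    by (rule yang_baxter_six_R_imp[OF R(3)[unfolded R_eq] nz P])
  have "U 1 \<noteq> 0"
    using six_R_eq_0 R(2) unfolding R_eq by blast
  then show ?thesis by (rule compatible_weights)
qed

section \<open>Sufficiency: construction of the R-weight\<close>

lemma mult_left_cancelI: "k * x = k * y \<Longrightarrow> k \<noteq> 0 \<Longrightarrow> x = y" for k x y :: complex
  by simp

text \<open>One equation determines \<open>A\<close>, and a second one has to hold as well. The
  letters are those of \<open>conserving_identity\<close>. The factor \<open>X\<close> on both sides
  of \<open>d\<close> lets it cover the case \<open>X = 0\<close> and the free fermionic case at
  once.\<close>

lemma A_consistent:
  fixes A X Y U0 V0 g p1 q1 q2 p1' q1' q2' r1 r2 r1' r2' :: complex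
  assumes A: "A * q1 * r2' = U0 * q1' * r2 + Y * p1 * r2'"
    and V: "V0 * r1 * r2' = r1' * r2"
    and X: "p1 * q2' + X * r1 * r2' = U0 * p1' * q2"
    and Y: "Y * (p1 * p1') = - g * X * (q1 * q1')"
    and r: "r1 * r2 * (q1' * q2') = r1' * r2' * (q1 * q2)"
    and d: "X * (r1 * r2) = X * ((1 + g) * (q1 * q2))"
    and nz: "q1 \<noteq> 0" "q2 \<noteq> 0" "r1 \<noteq> 0" "r2' \<noteq> 0"
  shows "A * p1' * r2 = X * q1' * r2 + V0 * p1 * r2'"
proof (rule mult_left_cancelI)
  have "(q1 * q2 * r1 * r2') * (A * p1' * r2) = (A * q1 * r2') * (p1' * r2 * r1 * q2)"
    by (simp only: mult_ac)
  also have "\<dots> = r1 * q1' * r2 * r2 * (U0 * p1' * q2) + (Y * (p1 * p1')) * (r2' * r2 * r1 * q2)"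
    unfolding A by (simp add: algebra_simps)
  also have "\<dots> = (r1 * r2 * (q1' * q2')) * (r2 * p1) + q1' * r2 * r2' * r1 * (X * (r1 * r2)) -
      g * X * (q1 * q1' * r2' * r2 * r1 * q2)"
    unfolding Y X[symmetric] by (simp add: algebra_simps)
  also have "\<dots> = (r1' * r2) * (r2' * q1 * q2 * p1) + X * (q1' * r2 * r2' * r1 * q1 * q2)"
    unfolding r d by (simp add: algebra_simps)
  also have "\<dots> = (q1 * q2 * r1 * r2') * (X * q1' * r2 + V0 * p1 * r2')"
    unfolding V[symmetric] by (simp add: algebra_simps)
  finally show "(q1 * q2 * r1 * r2') * (A * p1' * r2) =
    (q1 * q2 * r1 * r2') * (X * q1' * r2 + V0 * p1 * r2')" .
qed (use nz in simp)

text \<open>The diagonal weight \<open>D\<close> is overdetermined in the same way. After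
  eliminating \<open>D\<close>, \<open>V1\<close>, \<open>Y\<close> and \<open>U0\<close>, the
  remaining terms are matched by \<open>d\<close>.\<close>

lemma D_consistent:
  fixes D X Y U0 V1 g p1 p2 q1 q2 p1' p2' q1' q2' r1 r2 r1' r2' :: complex
  assumes D: "V1 * p2 * r2' + Y * q2' * r2 = D * p2' * r2"
    and V: "V1 * r1 * r2' = U0 * r1' * r2"
    and X: "p1 * q2' + X * r1 * r2' = U0 * p1' * q2"
    and Y: "Y * (p1 * p1') = - g * X * (q1 * q1')"
    and p: "p1 * p2 = g * (q1 * q2)" "p1' * p2' = g * (q1' * q2')"
    and r: "r1 * r2 * (q1' * q2') = r1' * r2' * (q1 * q2)"
    and d: "X * (r1 * r2) = X * ((1 + g) * (q1 * q2))"
    and nz: "p1 \<noteq> 0" "p1' \<noteq> 0" "p2' \<noteq> 0" "r1 \<noteq> 0" "r2 \<noteq> 0"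
  shows "X * p2 * r2' + q2' * r2 = D * q2 * r2'"
proof (rule mult_left_cancelI)
  have "(p1 * p1' * p2' * r1 * r2) * (D * q2 * r2') = (D * p2' * r2) * (p1 * p1' * r1 * q2 * r2')"
    by (simp only: mult_ac)
  also have "\<dots> = (V1 * r1 * r2') * (p1 * p2) * (p1' * q2 * r2') +
      (Y * (p1 * p1')) * (q2' * r2 * q2 * r2' * r1)"
    unfolding D[symmetric] by (simp add: algebra_simps)
  also have "\<dots> = g * r2 * ((r1' * r2' * (q1 * q2)) * (U0 * p1' * q2)) -
      g * X * (q1 * q1' * q2' * r2 * q2 * r2' * r1)"
    unfolding V Y p by (simp add: algebra_simps)
  also have "\<dots> = g * r2 * q1' * q2' * (r1 * r2 * p1 * q2' + r1 * r2' * (X * (r1 * r2)) - X * q1 * q2 * r2' * r1)"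
    unfolding r[symmetric] X[symmetric] by (simp add: algebra_simps)
  also have "\<dots> = g * r2 * q1' * q2' * (r1 * r2 * p1 * q2' + r1 * r2' * X * g * q1 * q2)"
    unfolding d by (simp add: algebra_simps)
  also have "\<dots> = r1 * r2 * (g * (q1' * q2')) * (X * r2' * (g * (q1 * q2)) + p1 * q2' * r2)"
    by (simp add: algebra_simps)
  also have "\<dots> = (p1 * p1' * p2' * r1 * r2) * (X * p2 * r2' + q2' * r2)"
    unfolding p[symmetric] by (simp add: algebra_simps)
  finally show "(p1 * p1' * p2' * r1 * r2) * (X * p2 * r2' + q2' * r2) =
    (p1 * p1' * p2' * r1 * r2) * (D * q2 * r2')" by (rule sym)
qed (use nz in simp)

lemma compatible_imp_ybe_system:
  fixes v w :: "'n::nontriv mod_ring row_weights"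
  assumes nz: "nonzero_weights v" "nonzero_weights w" and comp: "compatible v w"
  shows "\<exists>A D X Y U V P Q. ybe_system A D X Y U V P Q v w \<and> U 1 \<noteq> 0"
proof -
  have [simp]: "a1 v \<noteq> 0" "a2 v a \<noteq> 0" "b1 v \<noteq> 0" "b2 v a \<noteq> 0" "c1 v \<noteq> 0" "c2 v \<noteq> 0"
    "a1 w \<noteq> 0" "a2 w a \<noteq> 0" "b1 w \<noteq> 0" "b2 w a \<noteq> 0" "c1 w \<noteq> 0" "c2 w \<noteq> 0" for a
    using nz by (simp_all add: nonzero_weights_def)
  define g where "g = ratio v"
  have g_w: "g = ratio w" using comp by (simp add: compatible_def g_def)
  have av: "a1 v * a2 v a = g a * (b1 v * b2 v a)" for a
    by (simp add: g_def ratio_def)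
  have aw: "a1 w * a2 w a = g a * (b1 w * b2 w a)" for a
    by (simp add: g_w ratio_def)
  have [simp]: "g a \<noteq> 0" for a by (simp add: g_def ratio_def)
  have c: "c1 v * c2 v * (b1 w * b2 w 0) = c1 w * c2 w * (b1 v * b2 v 0)"
    using comp by (simp add: compatible_def)
  \<comment> \<open>The equations are homogeneous in the R-weight, so \<open>U 1 = 1\<close> is a
    normalization.\<close>
  obtain U where U1 [simp]: "U 1 = 1" and U_nz [simp]: "\<And>a. U a \<noteq> 0"
    and U_rec: "\<And>a. a \<noteq> 0 \<Longrightarrow> U (a + 1) = a1 w * b2 v a / (a1 v * b2 w a) * U a"
    by (rule ex_cyclic_recurrence[of "\<lambda>a. a1 w * b2 v a / (a1 v * b2 w a)"]) auto
  have U_b2: "U (a + 1) * a1 v * b2 w a = U a * a1 w * b2 v a" if "a \<noteq> 0" for a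
    by (simp add: U_rec[OF that])
  have U_a2: "U (a + 1) * a2 w a * b1 v = U a * a2 v a * b1 w" if "a \<noteq> 0" for a
  proof (rule mult_left_cancelI)
    have "(U (a + 1) * a1 v * b2 w a) * (a1 w * a2 w a) * (g a * (b1 v * b2 v a)) =
        (U a * a1 w * b2 v a) * (g a * (b1 w * b2 w a)) * (a1 v * a2 v a)"
      by (simp only: U_b2[OF that] aw av)
    then show "(a1 v * a1 w * b2 v a * b2 w a * g a) * (U (a + 1) * a2 w a * b1 v) =
        (a1 v * a1 w * b2 v a * b2 w a * g a) * (U a * a2 v a * b1 w)"
      by (simp only: mult_ac)
  qed simp
  define \<kappa> where "\<kappa> = c1 w * c2 v / (c1 v * c2 w)"
  have [simp]: "\<kappa> \<noteq> 0" by (simp add: \<kappa>_def)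
  \<comment> \<open>The recursions for \<open>V\<close> are those for \<open>U\<close> inverted, so
    \<open>V a * U a\<close> is constant. The constant is dictated by the equation that links
    \<open>V 1\<close> to \<open>U 0\<close>.\<close>
  define V where "V a = U 0 * \<kappa> / U a" for a
  have V0: "V 0 = \<kappa>" and V1: "V 1 = U 0 * \<kappa>" and VU: "V a * U a = U 0 * \<kappa>" for a
    by (simp_all add: V_def)
  have V_b2: "V (a + 1) * a1 w * b2 v a = V a * a1 v * b2 w a" if "a \<noteq> 0" for a
  proof (rule mult_left_cancelI)
    have "(V (a + 1) * U (a + 1)) * (U a * a1 w * b2 v a) = (V a * U a) * (U (a + 1) * a1 v * b2 w a)"
      by (simp only: U_b2[OF that] VU)
    then show "(U (a + 1) * U a) * (V (a + 1) * a1 w * b2 v a) =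
        (U (a + 1) * U a) * (V a * a1 v * b2 w a)"
      by (simp only: mult_ac)
  qed simp
  have V_a2: "V (a + 1) * a2 v a * b1 w = V a * a2 w a * b1 v" if "a \<noteq> 0" for a
  proof (rule mult_left_cancelI)
    have "(V (a + 1) * a1 w * b2 v a) * (a1 v * a2 v a) * (g a * (b1 w * b2 w a)) =
        (V a * a1 v * b2 w a) * (g a * (b1 v * b2 v a)) * (a1 w * a2 w a)"
      by (simp only: V_b2[OF that] aw av)
    then show "(a1 v * a1 w * b2 v a * b2 w a * g a) * (V (a + 1) * a2 v a * b1 w) =
        (a1 v * a1 w * b2 v a * b2 w a * g a) * (V a * a2 w a * b1 v)"
      by (simp only: mult_ac)
  qed simp
  \<comment> \<open>Both exchange weights are read off from the equations for \<open>U\<close> at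
    the passage from \<open>0\<close> to \<open>1\<close>.\<close>
  define X where "X = (U 0 * a1 w * b2 v 0 - a1 v * b2 w 0) / (c1 v * c2 w)"
  define Y where "Y = (a2 w 0 * b1 v - U 0 * a2 v 0 * b1 w) / (c1 v * c2 w)"
  have X: "a1 v * b2 w 0 + X * c1 v * c2 w = U 0 * a1 w * b2 v 0"
    by (simp add: X_def mult.assoc)
  have Y: "a2 w 0 * b1 v = U 0 * a2 v 0 * b1 w + Y * c1 v * c2 w"
    by (simp add: Y_def mult.assoc)
  have Y_eq: "Y * (a1 v * a1 w) = - g 0 * X * (b1 v * b1 w)"
    by (rule twist_relation[of 1 _ _ _ "c1 v" "c2 w" "U 0" _ _ "a2 w 0" _ "a2 v 0"])
      (use X Y av aw in simp_all)
  have prod_iff: "(\<Prod>a\<in>UNIV. a1 v * b2 w a) = (\<Prod>a\<in>UNIV. a1 w * b2 v a) \<longleftrightarrow>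
      U 0 * (a1 w * b2 v 0) = U 1 * (a1 v * b2 w 0)"
    by (rule cyclic_recurrence_prod_eq_iff) (auto simp: U_b2 simp flip: mult.assoc)
  have X_cases: "X = 0 \<or> defect v = 0 \<and> metaplectic g"
    using comp unfolding compatible_def prod_iff by (auto simp: X_def g_def mult.assoc)
  have d: "X * (c1 v * c2 v) = X * ((1 + g 0) * (b1 v * b2 v 0))"
  proof -
    have "c1 v * c2 v = (1 + g 0) * (b1 v * b2 v 0)" if "defect v = 0"
      using that by (simp add: defect_def av algebra_simps)
    then show ?thesis using X_cases by auto
  qed
  \<comment> \<open>If \<open>X = 0\<close>, then \<open>Y_eq\<close> makes both sides vanish;
    otherwise \<open>g\<close> is metaplectic and \<open>- g 0\<close> can be replaced.\<close>
  have YX: "Y * (a1 v * a1 w) = X * (g a * g (- a)) * (b1 v * b1 w)" if "a \<noteq> 0" for a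
    using X_cases Y_eq that by (auto simp: metaplectic_def)
  define A where "A = (U 0 * b1 w * c2 v + Y * a1 v * c2 w) / (b1 v * c2 w)"
  define D where "D = (V 1 * a2 v 0 * c2 w + Y * b2 w 0 * c2 v) / (a2 w 0 * c2 v)"
  have A1: "A * b1 v * c2 w = U 0 * b1 w * c2 v + Y * a1 v * c2 w"
    by (simp add: A_def mult.assoc)
  have D1: "V 1 * a2 v 0 * c2 w + Y * b2 w 0 * c2 v = D * a2 w 0 * c2 v"
    by (simp add: D_def mult.assoc)
  have \<kappa>: "\<kappa> * c1 v * c2 w = c1 w * c2 v"
    by (simp add: \<kappa>_def)
  have A2: "A * a1 w * c2 v = X * b1 w * c2 v + V 0 * a1 v * c2 w"
    by (rule A_consistent[OF A1 _ X Y_eq c d]) (simp_all add: V0 \<kappa>)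
  have D2: "X * a2 v 0 * c2 w + b2 w 0 * c2 v = D * b2 v 0 * c2 w"
    by (rule D_consistent[OF D1 _ X Y_eq av aw c d]) (simp_all add: V1 \<kappa> mult.assoc[of "U 0"])
  \<comment> \<open>For nonzero \<open>a\<close>, the equations force \<open>P a 0\<close> to be
    \<open>K1\<close> times \<open>U 0 * V a\<close>, and \<open>P 0 a\<close> to be
    \<open>K2\<close> times \<open>U a * V 0\<close>.\<close>
  define K1 where "K1 = b1 v * c2 w / (b1 w * c2 v * U 0)"
  define K2 where "K2 = a1 w * c2 v / (a1 v * c2 w * V 0)"
  have K1a: "K1 * U 0 * (b1 w * c2 v) = b1 v * c2 w"
    and K1b: "K1 * V 1 * (b1 w * c1 v) = b1 v * c1 w"
    and K2a: "K2 * V 0 * (a1 v * c2 w) = a1 w * c2 v"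
    and K2b: "K2 * (a1 v * c1 w) = a1 w * c1 v"
    by (simp_all add: K1_def K2_def V1 V0 \<kappa>_def field_simps)
  \<comment> \<open>Shifting both charges multiplies \<open>U b * V a\<close> by the right factor except where the cyclic order
    wraps around; the step from \<open>K2\<close> to \<open>K1\<close> (or back) makes up for that.\<close>
  define P where "P a b = (if a = b then D
    else (if charge_index a < charge_index b then K1 else K2) * (U b * V a))" for a b
  \<comment> \<open>Shift invariance makes \<open>Q\<close> a function of the difference of the
    charges; the equation for \<open>Q a 0\<close> gives its values.\<close>
  define Q where "Q a b = Y * b2 w (a - b) / a2 w (a - b)" for a b
  have P_step: "P (a + 1) (b + 1) * b2 v a * b2 w b = P a b * b2 w a * b2 v b" if ab: "a \<noteq> b" for a b
  proof -
    consider "a \<noteq> 0" "b \<noteq> 0" | "a = 0" "b \<noteq> 0" | "a \<noteq> 0" "b = 0"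
      using ab by blast
    then show ?thesis
    proof cases
      case 1
      define K where "K = (if charge_index a < charge_index b then K1 else K2)"
      have P: "P (a + 1) (b + 1) = K * (U (b + 1) * V (a + 1))" "P a b = K * (U b * V a)"
        using ab 1 by (simp_all add: P_def K_def charge_index_plus_1)
      show ?thesis
      proof (rule mult_left_cancelI)
        have "K * (U (b + 1) * a1 v * b2 w b) * (V (a + 1) * a1 w * b2 v a) =
            K * (U b * a1 w * b2 v b) * (V a * a1 v * b2 w a)"
          by (simp only: U_b2[OF 1(2)] V_b2[OF 1(1)])
        then show "(a1 v * a1 w) * (P (a + 1) (b + 1) * b2 v a * b2 w b) =
            (a1 v * a1 w) * (P a b * b2 w a * b2 v b)"
          unfolding P by (simp only: mult_ac)
      qed simp
    next
      case 2
      \<comment> \<open>The charge \<open>0\<close> comes last and its successor \<open>1\<close>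
        first, so the shift turns \<open>K2\<close> into \<open>K1\<close>. The relation
        \<open>c\<close> between the c-weights reconciles the two factors.\<close>
      have P: "P (a + 1) (b + 1) = K1 * (U (b + 1) * V 1)" "P a b = K2 * (U b * V 0)"
        using 2 charge_index_less_0[of b] by (simp_all add: P_def charge_index_plus_1)
      show ?thesis
      proof (rule mult_left_cancelI)
        have "(U (b + 1) * a1 v * b2 w b) * (K1 * V 1 * (b1 w * c1 v)) * (a1 w * c2 v) *
            (c1 w * c2 w * (b1 v * b2 v 0)) =
            (U b * a1 w * b2 v b) * (b1 v * c1 w) * (K2 * V 0 * (a1 v * c2 w)) *
            (c1 v * c2 v * (b1 w * b2 w 0))"
          by (simp only: U_b2[OF 2(2)] K1b K2a c)
        then show "(a1 v * a1 w * b1 v * b1 w * c1 v * c1 w * c2 v * c2 w) *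
            (P (a + 1) (b + 1) * b2 v a * b2 w b) =
            (a1 v * a1 w * b1 v * b1 w * c1 v * c1 w * c2 v * c2 w) * (P a b * b2 w a * b2 v b)"
          unfolding P unfolding 2(1) by (simp only: mult_ac)
      qed simp
    next
      case 3
      have P: "P (a + 1) (b + 1) = K2 * V (a + 1)" "P a b = K1 * (U 0 * V a)"
        using 3 charge_index_less_0[of a] by (simp_all add: P_def charge_index_plus_1)
      show ?thesis
      proof (rule mult_left_cancelI)
        have "(V (a + 1) * a1 w * b2 v a) * (K2 * (a1 v * c1 w)) * (b1 v * c2 w) *
            (c1 v * c2 v * (b1 w * b2 w 0)) =
            (V a * a1 v * b2 w a) * (a1 w * c1 v) * (K1 * U 0 * (b1 w * c2 v)) *
            (c1 w * c2 w * (b1 v * b2 v 0))"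
          by (simp only: V_b2[OF 3(1)] K1a K2b c)
        then show "(a1 v * a1 w * b1 v * b1 w * c1 v * c1 w * c2 v * c2 w) *
            (P (a + 1) (b + 1) * b2 v a * b2 w b) =
            (a1 v * a1 w * b1 v * b1 w * c1 v * c1 w * c2 v * c2 w) * (P a b * b2 w a * b2 v b)"
          unfolding P unfolding 3(2) by (simp only: mult_ac)
      qed simp
    qed
  qed
  have "ybe_system A D X Y U V P Q v w"
  proof unfold_locales
    show "nonzero_weights v" "nonzero_weights w" by (fact nz)+
    show "P a a = D" for a by (simp add: P_def)
    show "A * b1 v * c2 w = U 0 * b1 w * c2 v + Y * a1 v * c2 w" by (fact A1)
    show "A * a1 w * c2 v = X * b1 w * c2 v + V 0 * a1 v * c2 w" by (fact A2)
    show "V 1 * b1 w * c1 v + Y * a1 v * c1 w = A * b1 v * c1 w"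
      by (simp add: V1 \<kappa>_def A_def field_simps)
    show "X * b1 w * c1 v + U 1 * a1 v * c1 w = A * a1 w * c1 v"
    proof (rule mult_left_cancelI)
      have "c2 v * (A * a1 w * c1 v) = c1 v * (A * a1 w * c2 v)" by (simp only: mult_ac)
      also have "\<dots> = c1 v * X * b1 w * c2 v + a1 v * (\<kappa> * c1 v * c2 w)"
        unfolding A2 V0 by (simp add: algebra_simps)
      also have "\<dots> = c2 v * (X * b1 w * c1 v + U 1 * a1 v * c1 w)"
        unfolding \<kappa> by (simp add: algebra_simps)
      finally show "c2 v * (X * b1 w * c1 v + U 1 * a1 v * c1 w) = c2 v * (A * a1 w * c1 v)"
        by (rule sym)
    qed simp
    show "V 1 * c1 v * c2 w = U 0 * c1 w * c2 v"
      by (simp add: V1 \<kappa> mult.assoc flip: \<kappa>)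
    show "U 1 * c1 w * c2 v = V 0 * c1 v * c2 w"
      by (simp add: V0 \<kappa>)
    show "V 1 * a1 w * b2 v 0 = V 0 * a1 v * b2 w 0 + X * c1 w * c2 v"
      by (simp add: V0 V1 \<kappa>_def X_def field_simps)
    show "U 1 * a1 v * b2 w 0 + X * c1 v * c2 w = U 0 * a1 w * b2 v 0"
      using X by simp
    show "V 1 * a2 v 0 * b1 w + Y * c1 w * c2 v = V 0 * a2 w 0 * b1 v"
      by (simp add: V0 V1 \<kappa>_def Y_def field_simps)
    show "U 1 * a2 w 0 * b1 v = U 0 * a2 v 0 * b1 w + Y * c1 v * c2 w"
      using Y by simp
    show "V 1 * a2 v 0 * c2 w + Y * b2 w 0 * c2 v = D * a2 w 0 * c2 v" by (fact D1)
    show "X * a2 v 0 * c2 w + U 1 * b2 w 0 * c2 v = D * b2 v 0 * c2 w"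
      using D2 by simp
    show "D * a2 w 0 * c1 v = U 0 * a2 v 0 * c1 w + Y * b2 w 0 * c1 v"
      by (simp add: V1 \<kappa>_def D_def field_simps)
    show "D * b2 v 0 * c1 w = V 0 * b2 w 0 * c1 v + X * a2 v 0 * c1 w"
    proof (rule mult_left_cancelI)
      have "c2 w * (D * b2 v 0 * c1 w) = c1 w * (D * b2 v 0 * c2 w)" by (simp only: mult_ac)
      also have "\<dots> = c1 w * X * a2 v 0 * c2 w + b2 w 0 * (c1 w * c2 v)"
        unfolding D2[symmetric] by (simp add: algebra_simps)
      also have "\<dots> = c2 w * (V 0 * b2 w 0 * c1 v + X * a2 v 0 * c1 w)"
        unfolding \<kappa>[symmetric] V0 by (simp add: algebra_simps)
      finally show "c2 w * (D * b2 v 0 * c1 w) = c2 w * (V 0 * b2 w 0 * c1 v + X * a2 v 0 * c1 w)" .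
    qed simp
  next
    fix a :: "'n mod_ring" assume a: "a \<noteq> 0"
    show "U (a + 1) * a1 v * b2 w a = U a * a1 w * b2 v a" by (rule U_b2[OF a])
    show "U (a + 1) * a2 w a * b1 v = U a * a2 v a * b1 w" by (rule U_a2[OF a])
    show "V (a + 1) * a1 w * b2 v a = V a * a1 v * b2 w a" by (rule V_b2[OF a])
    show "V (a + 1) * a2 v a * b1 w = V a * a2 w a * b1 v" by (rule V_a2[OF a])
    have P: "P a 0 = K1 * (U 0 * V a)" "P 0 a = K2 * (U a * V 0)"
      "P (a + 1) 1 = K2 * V (a + 1)" "P 1 (a + 1) = K1 * (U (a + 1) * V 1)"
      using a charge_index_less_0[of a] by (simp_all add: P_def charge_index_plus_1)
    show "V (a + 1) * a2 v a * c2 w = P a 0 * a2 w a * c2 v"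
    proof (rule mult_left_cancelI)
      have "(V (a + 1) * a2 v a * b1 w) * (b1 v * c2 w) = (V a * a2 w a * b1 v) * (K1 * U 0 * (b1 w * c2 v))"
        by (simp only: V_a2[OF a] K1a)
      then show "(b1 v * b1 w) * (V (a + 1) * a2 v a * c2 w) = (b1 v * b1 w) * (P a 0 * a2 w a * c2 v)"
        unfolding P by (simp only: mult_ac)
    qed simp
    show "U (a + 1) * b2 w a * c2 v = P 0 a * b2 v a * c2 w"
    proof (rule mult_left_cancelI)
      have "(U (a + 1) * a1 v * b2 w a) * (a1 w * c2 v) = (U a * a1 w * b2 v a) * (K2 * V 0 * (a1 v * c2 w))"
        by (simp only: U_b2[OF a] K2a)
      then show "(a1 v * a1 w) * (U (a + 1) * b2 w a * c2 v) = (a1 v * a1 w) * (P 0 a * b2 v a * c2 w)"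
        unfolding P by (simp only: mult_ac)
    qed simp
    show "P (a + 1) 1 * b2 v a * c1 w = V a * b2 w a * c1 v"
    proof (rule mult_left_cancelI)
      have "(V (a + 1) * a1 w * b2 v a) * (K2 * (a1 v * c1 w)) = (V a * a1 v * b2 w a) * (a1 w * c1 v)"
        by (simp only: V_b2[OF a] K2b)
      then show "(a1 v * a1 w) * (P (a + 1) 1 * b2 v a * c1 w) = (a1 v * a1 w) * (V a * b2 w a * c1 v)"
        unfolding P by (simp only: mult_ac)
    qed simp
    show "P 1 (a + 1) * a2 w a * c1 v = U a * a2 v a * c1 w"
    proof (rule mult_left_cancelI)
      have "(U (a + 1) * a2 w a * b1 v) * (K1 * V 1 * (b1 w * c1 v)) = (U a * a2 v a * b1 w) * (b1 v * c1 w)"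
        by (simp only: U_a2[OF a] K1b)
      then show "(b1 v * b1 w) * (P 1 (a + 1) * a2 w a * c1 v) = (b1 v * b1 w) * (U a * a2 v a * c1 w)"
        unfolding P by (simp only: mult_ac)
    qed simp
    show "Q a 0 * a2 w a = Y * b2 w a" "Q (a + 1) 1 * a2 w a = Y * b2 w a"
      by (simp_all add: Q_def)
    \<comment> \<open>The difference of the charges is now \<open>- a\<close>, while the equation
      involves the weights at \<open>a\<close>. \<open>YX\<close> supplies the factor
      \<open>g a * g (- a)\<close> that joins them.\<close>
    have "Y * b2 w (- a) / a2 w (- a) * b2 v a = X * a2 v a"
    proof (rule mult_left_cancelI)
      have "(a1 v * a1 w * a2 w (- a)) * (Y * b2 w (- a) / a2 w (- a) * b2 v a) =
          (Y * (a1 v * a1 w)) * (b2 w (- a) * b2 v a)"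
        by simp
      also have "\<dots> = X * (g a * (b1 v * b2 v a)) * (g (- a) * (b1 w * b2 w (- a)))"
        unfolding YX[OF a] by (simp only: mult_ac)
      also have "\<dots> = (a1 v * a1 w * a2 w (- a)) * (X * a2 v a)"
        unfolding av[symmetric] aw[symmetric] by (simp only: mult_ac)
      finally show "(a1 v * a1 w * a2 w (- a)) * (Y * b2 w (- a) / a2 w (- a) * b2 v a) =
          (a1 v * a1 w * a2 w (- a)) * (X * a2 v a)" .
    qed simp
    then show "Q 0 a * b2 v a = X * a2 v a" "Q 1 (a + 1) * b2 v a = X * a2 v a"
      by (simp_all add: Q_def)
  next
    fix a b :: "'n mod_ring" assume ab: "a \<noteq> b"
    show "P (a + 1) (b + 1) * b2 v a * b2 w b = P a b * b2 w a * b2 v b"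
      by (rule P_step[OF ab])
    show "P (a + 1) (b + 1) * a2 v a * a2 w b = P a b * a2 w a * a2 v b"
    \<comment> \<open>Expressing the a-weights through \<open>g\<close> and the b-weights brings the
      same factor \<open>g a * g b\<close> to both sides, which reduces the claim to the version for
      \<open>b2\<close>.\<close>
    proof (rule mult_left_cancelI)
      have "(P (a + 1) (b + 1) * b2 v a * b2 w b) * (a1 v * a2 v a) * (a1 w * a2 w b) *
          (g a * (b1 w * b2 w a)) * (g b * (b1 v * b2 v b)) =
          (P a b * b2 w a * b2 v b) * (g a * (b1 v * b2 v a)) * (g b * (b1 w * b2 w b)) *
          (a1 w * a2 w a) * (a1 v * a2 v b)"
        by (simp only: P_step[OF ab] av aw)
      then show "(b2 v a * b2 w b * a1 v * a1 w * g a * b1 w * b2 w a * g b * b1 v * b2 v b) *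
          (P (a + 1) (b + 1) * a2 v a * a2 w b) =
          (b2 v a * b2 w b * a1 v * a1 w * g a * b1 w * b2 w a * g b * b1 v * b2 v b) *
          (P a b * a2 w a * a2 v b)"
        by (simp only: mult_ac)
    qed simp
    show "Q (a + 1) (b + 1) = Q a b"
      by (simp add: Q_def)
  qed
  moreover have "U 1 \<noteq> 0" by simp
  ultimately show ?thesis by blast
qed

lemma compatible_iff_yang_baxter:
  fixes v w :: "'n::nontriv mod_ring row_weights"
  assumes "nonzero_weights v" "nonzero_weights w"
  shows "(\<exists>R. spin_conserving R \<and> (\<exists>x y z t. R x y z t \<noteq> 0) \<and> yang_baxter R v w) \<longleftrightarrow>
    compatible v w"
proof
  assume "\<exists>R. spin_conserving R \<and> (\<exists>x y z t. R x y z t \<noteq> 0) \<and> yang_baxter R v w"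
  then show "compatible v w"
    using yang_baxter_imp_compatible[OF assms] by blast
next
  assume "compatible v w"
  then obtain A D X Y U V P Q where sys: "ybe_system A D X Y U V P Q v w" and "U 1 \<noteq> 0"
    using compatible_imp_ybe_system[OF assms] by blast
  let ?R = "six_R A U V (\<lambda>_. X) (\<lambda>_. Y) P Q"
  have "?R DPlus (DMinus 1) DPlus (DMinus 1) \<noteq> 0"
    using \<open>U 1 \<noteq> 0\<close> by simp
  then show "\<exists>R. spin_conserving R \<and> (\<exists>x y z t. R x y z t \<noteq> 0) \<and> yang_baxter R v w"
    using spin_conserving_six_R yang_baxter_six_RI[OF sys] by blast
qed

section \<open>From pairs of rows to the whole family\<close>

lemma compatible_quotients_iff:
  fixes v w :: "'n::nontriv mod_ring row_weights"
  assumes nz: "nonzero_weights v" "nonzero_weights w"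
  shows "ratio v = ratio w \<and> c1 v * c2 v * (b1 w * b2 w 0) = c1 w * c2 w * (b1 v * b2 v 0) \<longleftrightarrow>
    (\<forall>k. (a1 v * a2 v k) / (b1 v * b2 v k) = (a1 w * a2 w k) / (b1 w * b2 w k)) \<and>
    (a1 v * a2 v 0) / (c1 v * c2 v) = (a1 w * a2 w 0) / (c1 w * c2 w) \<and>
    (b1 v * b2 v 0) / (c1 v * c2 v) = (b1 w * b2 w 0) / (c1 w * c2 w)"
    (is "?l \<longleftrightarrow> ?k \<and> ?a \<and> ?b")
proof -
  have b: "?b \<longleftrightarrow> c1 v * c2 v * (b1 w * b2 w 0) = c1 w * c2 w * (b1 v * b2 v 0)"
    using nz by (subst frac_eq_eq) (auto simp: nonzero_weights_def mult_ac)
  have k: "?k \<longleftrightarrow> ratio v = ratio w"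
    by (simp add: ratio_def fun_eq_iff)
  \<comment> \<open>The quotient of the a-weights by the c-weights is a product of two of the other
    quotients, so its equality follows from theirs.\<close>
  have "(a1 u * a2 u 0) / (c1 u * c2 u) = ratio u 0 * ((b1 u * b2 u 0) / (c1 u * c2 u))"
    if "nonzero_weights u" for u :: "'n mod_ring row_weights"
    using that by (simp add: ratio_def nonzero_weights_def)
  then have "?a" if ?k ?b
    using that nz by (simp only: k)
  with b k show ?thesis by blast
qed

lemma defect_eq_0_iff:
  fixes w :: "'n::nontriv mod_ring row_weights"
  assumes "nonzero_weights w"
  shows "defect w = 0 \<longleftrightarrow> c1 w * c2 w = (ratio w 0 + 1) * (b1 w * b2 w 0)"
  using assms by (auto simp: defect_def ratio_def nonzero_weights_def algebra_simps)

text \<open>The defect vanishes when the quotient of \<open>c1 * c2\<close> by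
  \<open>b1 * b2 0\<close> equals the ratio at \<open>0\<close> plus one, and compatible rows share
  both quantities.\<close>

lemma compatible_defect_eq_0:
  fixes v w :: "'n::nontriv mod_ring row_weights"
  assumes nz: "nonzero_weights v" "nonzero_weights w" and comp: "compatible v w" "defect v = 0"
  shows "defect w = 0"
proof -
  have "c1 w * c2 w * (b1 v * b2 v 0) = c1 v * c2 v * (b1 w * b2 w 0)"
    using comp(1) by (simp add: compatible_def)
  also have "c1 v * c2 v = (ratio w 0 + 1) * (b1 v * b2 v 0)"
    using comp defect_eq_0_iff[OF nz(1)] by (simp add: compatible_def)
  finally have "(b1 v * b2 v 0) * (c1 w * c2 w) = (b1 v * b2 v 0) * ((ratio w 0 + 1) * (b1 w * b2 w 0))"
    by (simp only: mult_ac)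
  then have "c1 w * c2 w = (ratio w 0 + 1) * (b1 w * b2 w 0)"
    using nz(1) by (simp add: nonzero_weights_def)
  then show ?thesis
    using defect_eq_0_iff[OF nz(2)] by simp
qed

lemma free_fermionic_iff: "free_fermionic g w \<longleftrightarrow> defect w = 0 \<and> ratio w = g"
  by (auto simp: free_fermionic_def defect_def ratio_def fun_eq_iff)

theorem theorem1p3:
  fixes I :: "'i set"
    and W :: "'i \<Rightarrow> 'n::nontriv mod_ring row_weights"
  assumes "\<And>i. i \<in> I \<Longrightarrow> nonzero_weights (W i)"
  shows "solvable I W \<longleftrightarrow>
    (\<exists>g. metaplectic g \<and> (\<forall>i\<in>I. free_fermionic g (W i))) \<or>
    ((\<forall>i\<in>I. \<forall>j\<in>I.
        (\<forall>k. (a1 (W i) * a2 (W i) k) / (b1 (W i) * b2 (W i) k) =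
              (a1 (W j) * a2 (W j) k) / (b1 (W j) * b2 (W j) k)) \<and>
        (a1 (W i) * a2 (W i) 0) / (c1 (W i) * c2 (W i)) =
          (a1 (W j) * a2 (W j) 0) / (c1 (W j) * c2 (W j)) \<and>
        (b1 (W i) * b2 (W i) 0) / (c1 (W i) * c2 (W i)) =
          (b1 (W j) * b2 (W j) 0) / (c1 (W j) * c2 (W j))) \<and>
     (\<forall>i\<in>I. \<forall>j\<in>I.
        (\<Prod>p<CARD('n). a1 (W i) * b2 (W j) (of_nat p)) =
        (\<Prod>p<CARD('n). a1 (W j) * b2 (W i) (of_nat p))))"
    (is "_ \<longleftrightarrow> ?fermionic \<or> ?quotients \<and> ?products")
proof -
  define same where "same v w \<longleftrightarrow>
    ratio v = ratio w \<and> c1 v * c2 v * (b1 w * b2 w 0) = c1 w * c2 w * (b1 v * b2 v 0)"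
    for v w :: "'n mod_ring row_weights"
  define products where "products v w \<longleftrightarrow>
    (\<Prod>a\<in>UNIV. a1 v * b2 w a) = (\<Prod>a\<in>UNIV. a1 w * b2 v a)"
    for v w :: "'n mod_ring row_weights"
  have compatible: "compatible v w \<longleftrightarrow>
      same v w \<and> (products v w \<or> defect v = 0 \<and> metaplectic (ratio v))"
    for v w :: "'n mod_ring row_weights"
    by (simp add: compatible_def same_def products_def)
  have solvable: "solvable I W \<longleftrightarrow> (\<forall>i\<in>I. \<forall>j\<in>I. compatible (W i) (W j))"
    unfolding solvable_def by (intro ball_cong refl compatible_iff_yang_baxter assms)
  have quotients: "?quotients \<longleftrightarrow> (\<forall>i\<in>I. \<forall>j\<in>I. same (W i) (W j))"
    unfolding same_def by (intro ball_cong refl compatible_quotients_iff[symmetric] assms)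
  have products: "?products \<longleftrightarrow> (\<forall>i\<in>I. \<forall>j\<in>I. products (W i) (W j))"
    unfolding products_def prod_of_nat_mod_ring[of "\<lambda>a. a1 (W _) * b2 (W _) a"] by (rule refl)
  show ?thesis
    unfolding solvable quotients products
  proof (intro iffI)
    assume comp: "\<forall>i\<in>I. \<forall>j\<in>I. compatible (W i) (W j)"
    show "?fermionic \<or> (\<forall>i\<in>I. \<forall>j\<in>I. same (W i) (W j)) \<and> (\<forall>i\<in>I. \<forall>j\<in>I. products (W i) (W j))"
    proof (cases "\<forall>i\<in>I. \<forall>j\<in>I. products (W i) (W j)")
      case True
      then show ?thesis using comp compatible by blast
    next
      case False
      \<comment> \<open>A single pair that violates the product condition makes its first row free
        fermionic with a metaplectic ratio; compatibility with that row spreads this to all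
        rows.\<close>
      then obtain i where i: "i \<in> I" "defect (W i) = 0" "metaplectic (ratio (W i))"
        using comp compatible by blast
      have "free_fermionic (ratio (W i)) (W j)" if "j \<in> I" for j
        unfolding free_fermionic_iff
      proof
        have ij: "compatible (W i) (W j)" using comp i(1) that by blast
        show "defect (W j) = 0"
          by (rule compatible_defect_eq_0[OF assms[OF i(1)] assms[OF that] ij i(2)])
        show "ratio (W j) = ratio (W i)"
          using ij by (simp add: compatible_def)
      qed
      with i(3) show ?thesis by blast
    qed
  next
    assume "?fermionic \<or> (\<forall>i\<in>I. \<forall>j\<in>I. same (W i) (W j)) \<and> (\<forall>i\<in>I. \<forall>j\<in>I. products (W i) (W j))"
    then show "\<forall>i\<in>I. \<forall>j\<in>I. compatible (W i) (W j)"
    proof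
      assume ?fermionic
      then obtain g where g: "metaplectic g" "\<And>i. i \<in> I \<Longrightarrow> defect (W i) = 0 \<and> ratio (W i) = g"
        unfolding free_fermionic_iff by blast
      show ?thesis
      proof (intro ballI)
        fix i j assume ij: "i \<in> I" "j \<in> I"
        \<comment> \<open>The factor \<open>g 0 + 1\<close> is common to all rows, which gives the
          relation between the c-weights of any two of them.\<close>
        have "c1 (W k) * c2 (W k) = (g 0 + 1) * (b1 (W k) * b2 (W k) 0)" if "k \<in> I" for k
          using g(2)[OF that] defect_eq_0_iff[OF assms[OF that]] by simp
        from this[OF ij(1)] this[OF ij(2)] show "compatible (W i) (W j)"
          using g ij by (simp add: compatible_def)
      qed
    qed (simp add: compatible)
  qed
qed

end
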